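(* Let $K$ be a field and let $g\ge 4$ be an integer. Then there exists a uniform, admissible and unmixed clutter $\mathcal{C}$ with $\operatorname{ht} I(\mathcal{C})=g$ that is not Cohen-Macaulay.
   Context: A clutter $\mathcal{C}$ consists of a finite vertex set $V(\mathcal{C})=\{x_1,\dots,x_n\}$ and a family $E(\mathcal{C})$ of nonempty subsets of $V(\mathcal{C})$ (edges), none of which properly contains another. It is uniform if all edges have the same cardinality. Let $K$ be a field, identify the vertices with the variables of $R=K[x_1,\dots,x_n]$, and let $I(\mathcal{C})=\langle \prod_{x_i\in e}x_i \mid e\in E(\mathcal{C})\rangle\subset R$ be the edge ideal. $\mathcal{C}$ is Cohen-Macaulay if $R/I(\mathcal{C})$ is a Cohen-Macaulay ring. A vertex cover is a subset $C\subseteq V(\mathcal{C})$ meeting every edge; it is minimal if no proper subset is a vertex cover. $\operatorname{ht} I(\mathcal{C})$ equals the smallest cardinality of a minimal vertex cover. $\mathcal{C}$ is unmixed if all its minimal vertex covers have the same cardinality. Admissible: let $g=\operatorname{ht} I(\mathcal{C})$. Suppose that for some positive integer $d$ there are two partitions $\{X^1,\dots,X^d\}$ and $\{e_1,\dots,e_g\}$ of $V(\mathcal{C})$ with $|e_i\cap X^j|\le 1$ for all $i,j$. A subset $e\subseteq V(\mathcal{C})$ of size $k$ with $|e\cap X^i|\le 1$ for all $i$ is admissible if $e$ meets exactly the classes $X^1,\dots,X^k$ and, writing $j_l$ for the index such that the vertex of $e\cap X^l$ lies in $e_{j_l}$, one has $j_1\le j_2\le\cdots\le j_k$. The clutter $\mathcal{C}$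 is admissible if (for some such partitions) $e_1,\dots,e_g\in E(\mathcal{C})$ and all edges of $\mathcal{C}$ are admissible. *)

theory Defs
  imports
    "HOL-Algebra.QuotRing"
    "HOL-Algebra.Ring_Divisibility"
    "HOL-Library.Poly_Mapping"
    "HOL-Library.Extended_Nat"
    "HOL-Library.Disjoint_Sets"
begin

section \<open>Krull dimension, height and Cohen-Macaulay rings\<close>

definition prime_chain :: "('a, 'b) ring_scheme \<Rightarrow> (nat \<Rightarrow> 'a set) \<Rightarrow> nat \<Rightarrow> bool" where
  "prime_chain R P n \<longleftrightarrow> (\<forall>i\<le>n. primeideal (P i) R) \<and> (\<forall>i<n. P i \<subset> P (Suc i))"

definition krull_dim :: "('a, 'b) ring_scheme \<Rightarrow> enat" where
  "krull_dim R = Sup {enat n | n. \<exists>P. prime_chain R P n}"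

definition prime_height :: "('a, 'b) ring_scheme \<Rightarrow> 'a set \<Rightarrow> enat" where
  "prime_height R p = Sup {enat n | n. \<exists>P. prime_chain R P n \<and> P n = p}"

definition ideal_height :: "('a, 'b) ring_scheme \<Rightarrow> 'a set \<Rightarrow> enat" where
  "ideal_height R I = Inf {prime_height R p | p. primeideal p R \<and> I \<subseteq> p}"

definition regular_sequence :: "('a, 'b) ring_scheme \<Rightarrow> 'a list \<Rightarrow> bool" where
  "regular_sequence R xs \<longleftrightarrow>
     set xs \<subseteq> carrier R \<and> Idl\<^bsub>R\<^esub> (set xs) \<noteq> carrier R \<and>
     (\<forall>i<length xs. \<forall>a\<in>carrier R.
        a \<otimes>\<^bsub>R\<^esub> (xs ! i) \<in> Idl\<^bsub>R\<^esub> (set (take i xs)) \<longrightarrow> a \<in> Idl\<^bsub>R\<^esub> (set (take i xs)))"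

text \<open>When \<open>R\<close> is Noetherian local with maximal ideal \<open>m\<close>, its depth is \<open>depth R m\<close>.\<close>

definition depth :: "('a, 'b) ring_scheme \<Rightarrow> 'a set \<Rightarrow> enat" where
  "depth R I = Sup {enat (length xs) | xs. set xs \<subseteq> I \<and> regular_sequence R xs}"

definition cohen_macaulay_local :: "('a, 'b) ring_scheme \<Rightarrow> bool" where
  "cohen_macaulay_local R \<longleftrightarrow>
     cring R \<and> noetherian_ring R \<and> (\<exists>!m. maximalideal m R) \<and>
     (\<forall>m. maximalideal m R \<longrightarrow> depth R m = krull_dim R)"

definition frac_rel ::
  "('a, 'b) ring_scheme \<Rightarrow> 'a set \<Rightarrow> (('a \<times> 'a) \<times> ('a \<times> 'a)) set" where
  "frac_rel R S = {((a, s), (b, t)). a \<in> carrier R \<and> b \<in> carrier R \<and> s \<in> S \<and> t \<in> S \<and>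
     (\<exists>u\<in>S. u \<otimes>\<^bsub>R\<^esub> (a \<otimes>\<^bsub>R\<^esub> t \<ominus>\<^bsub>R\<^esub> b \<otimes>\<^bsub>R\<^esub> s) = \<zero>\<^bsub>R\<^esub>)}"

text \<open>The ring of fractions of \<open>R\<close> with denominators in a multiplicatively closed
  subset \<open>S\<close> of \<open>R\<close>; the fraction \<open>a/s\<close> is the equivalence class of \<open>(a, s)\<close>.\<close>

definition localization :: "('a, 'b) ring_scheme \<Rightarrow> 'a set \<Rightarrow> ('a \<times> 'a) set ring" where
  "localization R S =
     \<lparr>carrier = (carrier R \<times> S) // frac_rel R S,
      mult = (\<lambda>X Y. \<Union>(a, s)\<in>X. \<Union>(b, t)\<in>Y.
                frac_rel R S `` {(a \<otimes>\<^bsub>R\<^esub> b, s \<otimes>\<^bsub>R\<^esub> t)}),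
      one = frac_rel R S `` {(\<one>\<^bsub>R\<^esub>, \<one>\<^bsub>R\<^esub>)},
      zero = frac_rel R S `` {(\<zero>\<^bsub>R\<^esub>, \<one>\<^bsub>R\<^esub>)},
      add = (\<lambda>X Y. \<Union>(a, s)\<in>X. \<Union>(b, t)\<in>Y.
                frac_rel R S `` {(a \<otimes>\<^bsub>R\<^esub> t \<oplus>\<^bsub>R\<^esub> b \<otimes>\<^bsub>R\<^esub> s, s \<otimes>\<^bsub>R\<^esub> t)})\<rparr>"

definition cohen_macaulay :: "('a, 'b) ring_scheme \<Rightarrow> bool" where
  "cohen_macaulay R \<longleftrightarrow>
     cring R \<and> noetherian_ring R \<and>
     (\<forall>p. primeideal p R \<longrightarrow> cohen_macaulay_local (localization R (carrier R - p)))"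


section \<open>Polynomial rings\<close>

text \<open>A polynomial maps its monomials to their coefficients, and a monomial maps its variables to
  their exponents. The ring \<open>K[x\<^sub>v | v \<in> V]\<close> consists of the polynomials in which only variables
  from \<open>V\<close> occur.\<close>

type_synonym ('v, 'k) mpoly = "('v \<Rightarrow>\<^sub>0 nat) \<Rightarrow>\<^sub>0 'k"

definition polynomial_ring :: "'v set \<Rightarrow> ('v, 'k::field) mpoly ring" where
  "polynomial_ring V =
     \<lparr>carrier = {p. \<forall>m\<in>Poly_Mapping.keys p. Poly_Mapping.keys m \<subseteq> V},
      mult = (*), one = 1, zero = 0, add = (+)\<rparr>"

definition variable :: "'v \<Rightarrow> ('v, 'k::field) mpoly" where
  "variable v = Poly_Mapping.single (Poly_Mapping.single v 1) 1"


section \<open>Clutters\<close>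

definition clutter :: "'v set \<Rightarrow> 'v set set \<Rightarrow> bool" where
  "clutter V E \<longleftrightarrow> finite V \<and> (\<forall>e\<in>E. e \<noteq> {} \<and> e \<subseteq> V) \<and> (\<forall>e\<in>E. \<forall>f\<in>E. \<not> e \<subset> f)"

definition uniform :: "'v set set \<Rightarrow> bool" where
  "uniform E \<longleftrightarrow> (\<forall>e\<in>E. \<forall>f\<in>E. card e = card f)"

definition vertex_cover :: "'v set \<Rightarrow> 'v set set \<Rightarrow> 'v set \<Rightarrow> bool" where
  "vertex_cover V E C \<longleftrightarrow> C \<subseteq> V \<and> (\<forall>e\<in>E. C \<inter> e \<noteq> {})"

definition minimal_vertex_cover :: "'v set \<Rightarrow> 'v set set \<Rightarrow> 'v set \<Rightarrow> bool" where
  "minimal_vertex_cover V E C \<longleftrightarrow> vertex_cover V E C \<and> (\<forall>D. D \<subset> C \<longrightarrow> \<not> vertex_cover V E D)"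

definition unmixed :: "'v set \<Rightarrow> 'v set set \<Rightarrow> bool" where
  "unmixed V E \<longleftrightarrow>
     (\<forall>C D. minimal_vertex_cover V E C \<longrightarrow> minimal_vertex_cover V E D \<longrightarrow> card C = card D)"

text \<open>The field \<open>K\<close> enters through its type. Where that type cannot be inferred, it is passed as
  an argument of type \<^typ>\<open>'k itself\<close>.\<close>

definition edge_ideal :: "'v set \<Rightarrow> 'v set set \<Rightarrow> ('v, 'k::field) mpoly set" where
  "edge_ideal V E = Idl\<^bsub>polynomial_ring V\<^esub> {\<Prod>v\<in>e. variable v | e. e \<in> E}"

definition edge_ideal_height :: "'k::field itself \<Rightarrow> 'v set \<Rightarrow> 'v set set \<Rightarrow> enat" where
  "edge_ideal_height K V E =
     ideal_height (polynomial_ring V) (edge_ideal V E :: ('v, 'k) mpoly set)"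

definition cohen_macaulay_clutter :: "'k::field itself \<Rightarrow> 'v set \<Rightarrow> 'v set set \<Rightarrow> bool" where
  "cohen_macaulay_clutter K V E \<longleftrightarrow>
     cohen_macaulay (polynomial_ring V Quot (edge_ideal V E :: ('v, 'k) mpoly set))"

definition indexed_partition :: "'v set \<Rightarrow> nat \<Rightarrow> (nat \<Rightarrow> 'v set) \<Rightarrow> bool" where
  "indexed_partition V n P \<longleftrightarrow> inj_on P {1..n} \<and> partition_on V (P ` {1..n})"

text \<open>Below, \<open>X 1, \<dots>, X d\<close> are the classes of the first partition and \<open>B 1, \<dots>, B g\<close> those of
  the second one.\<close>

definition admissible_set ::
  "'v set \<Rightarrow> nat \<Rightarrow> (nat \<Rightarrow> 'v set) \<Rightarrow> nat \<Rightarrow> (nat \<Rightarrow> 'v set) \<Rightarrow> 'v set \<Rightarrow> bool" where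
  "admissible_set V d X g B e \<longleftrightarrow>
     e \<subseteq> V \<and> (\<forall>l\<in>{1..d}. card (e \<inter> X l) \<le> 1) \<and>
     {l\<in>{1..d}. e \<inter> X l \<noteq> {}} = {1..card e} \<and>
     (\<forall>l\<in>{1..card e}. \<forall>m\<in>{1..card e}. \<forall>i\<in>{1..g}. \<forall>j\<in>{1..g}.
        l \<le> m \<longrightarrow> e \<inter> X l \<inter> B i \<noteq> {} \<longrightarrow> e \<inter> X m \<inter> B j \<noteq> {} \<longrightarrow> i \<le> j)"

definition admissible :: "'k::field itself \<Rightarrow> 'v set \<Rightarrow> 'v set set \<Rightarrow> bool" where
  "admissible K V E \<longleftrightarrow>
     (\<exists>g d X B. edge_ideal_height K V E = enat g \<and> d \<ge> 1 \<and>
        indexed_partition V d X \<and> indexed_partition V g B \<and>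
        (\<forall>i\<in>{1..g}. \<forall>j\<in>{1..d}. card (B i \<inter> X j) \<le> 1) \<and>
        (\<forall>i\<in>{1..g}. B i \<in> E) \<and>
        (\<forall>e\<in>E. admissible_set V d X g B e))"

end

theory Submission
  imports Defs "HOL.Vector_Spaces"
begin

text \<open>The clutter consists of \<open>g\<close> disjoint blocks of three vertices and four crossing edges. Inverting the
  vertices outside two suitable vertex covers \<open>C\<close> and \<open>D\<close> turns the edge ideal into
  \<open>P\<^sub>C \<inter> P\<^sub>D\<close>, the edge ideal of a four-cycle up to variables. At the prime \<open>P\<^sub>C + P\<^sub>D\<close> the
  quotient has dimension two, but, its punctured spectrum being disconnected, depth at most one.

  The height of the edge ideal is that of a prime generated by \<open>g\<close> variables. It is bounded above by
  extending chains of primes and using \<open>dim K[V] \<le> |V|\<close>; the latter holds because a longer chain would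
  yield more than \<open>|V|\<close> algebraically independent elements, contradicting a count of monomials.\<close>

section \<open>Polynomial rings and ideals of variables\<close>

text \<open>The four-cycle is 3-4-8-7. Inverting 0, 5, 6, 11 turns {3,4,5}, {0,4,8}, {6,7,8},
  {3,7,11} into its edges, and its independence complex is the pair of disjoint segments {3,8} and
  {4,7}. The obstacle is to keep unmixedness: for g = 4, the blocks with only {0,4,8} and {3,7,11}
  added have the minimal cover {1,3,4,6,9}, which uses two vertices of one block. The crossing edges
  {0,7,8} and {3,4,11} exclude such covers, and once 0 and 11 are inverted they become edges already
  present in the cycle. Vertex 11 lies in the fourth block, whence g >= 4; further blocks only add
  variables common to both primes. As Cohen-Macaulayness is demanded at every prime, a single bad
  localization suffices. Only primes generated by variables need an upper bound on their height, so
  a bound on the dimension takes the place of Krull's height theorem.\<close>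

abbreviation "keys \<equiv> Poly_Mapping.keys"
abbreviation "lookup \<equiv> Poly_Mapping.lookup"
abbreviation "single \<equiv> Poly_Mapping.single"

lemma polynomial_ring_simps [simp]:
  "p \<otimes>\<^bsub>polynomial_ring V\<^esub> q = p * q"
  "p \<oplus>\<^bsub>polynomial_ring V\<^esub> q = p + q"
  "\<one>\<^bsub>polynomial_ring V\<^esub> = 1"
  "\<zero>\<^bsub>polynomial_ring V\<^esub> = 0"
  by (simp_all add: polynomial_ring_def)

lemma in_carrier_polynomial_ring:
  "p \<in> carrier (polynomial_ring V) \<longleftrightarrow> (\<forall>m\<in>keys p. keys m \<subseteq> V)"
  by (simp add: polynomial_ring_def)

lemma keys_plus_nat: "keys (m + n) = keys m \<union> keys (n :: 'v \<Rightarrow>\<^sub>0 nat)"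
  by (auto simp: in_keys_iff lookup_add)

lemma keys_mult_elim:
  assumes "m \<in> keys (p * q)"
  obtains a b where "a \<in> keys p" "b \<in> keys q" "m = a + b"
  using assms keys_mult[of p q] by auto

lemma keys_add_cases:
  assumes "m \<in> keys (p + q)"
  shows "m \<in> keys p \<or> m \<in> keys q"
  using assms Poly_Mapping.keys_add[of p q] by auto

lemma cring_polynomial_ring: "cring (polynomial_ring V :: ('v, 'k::field) mpoly ring)"
proof (rule cringI)
  show "abelian_group (polynomial_ring V :: ('v, 'k) mpoly ring)"
  proof (rule abelian_groupI)
    fix p :: "('v, 'k) mpoly"
    assume "p \<in> carrier (polynomial_ring V)"
    then show "\<exists>q\<in>carrier (polynomial_ring V). q \<oplus>\<^bsub>polynomial_ring V\<^esub> p = \<zero>\<^bsub>polynomial_ring V\<^esub>"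
      by (intro bexI[of _ "- p"]) (auto simp: in_carrier_polynomial_ring in_keys_iff)
  qed (auto simp: in_carrier_polynomial_ring ac_simps dest!: keys_add_cases)
  show "comm_monoid (polynomial_ring V :: ('v, 'k) mpoly ring)"
  proof (rule comm_monoidI)
    fix p q :: "('v, 'k) mpoly"
    assume pq: "p \<in> carrier (polynomial_ring V)" "q \<in> carrier (polynomial_ring V)"
    have "keys m \<subseteq> V" if "m \<in> keys (p * q)" for m
      using that
    proof (rule keys_mult_elim)
      fix a b assume "a \<in> keys p" "b \<in> keys q" "m = a + b"
      then show ?thesis using pq by (simp add: in_carrier_polynomial_ring keys_plus_nat)
    qed
    then show "p \<otimes>\<^bsub>polynomial_ring V\<^esub> q \<in> carrier (polynomial_ring V)"
      by (simp add: in_carrier_polynomial_ring)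
  qed (auto simp: in_carrier_polynomial_ring ac_simps)
qed (simp add: algebra_simps)

text \<open>Bridge from the record operations to the class operations on polynomials, so that later
  computations are ordinary ring arithmetic.\<close>

lemma in_ideal_polynomial_ring:
  fixes J :: "('v, 'k::field) mpoly set"
  assumes "ideal J (polynomial_ring V)"
  shows "0 \<in> J"
    and "p \<in> J \<Longrightarrow> q \<in> J \<Longrightarrow> p + q \<in> J"
    and "p \<in> J \<Longrightarrow> q \<in> J \<Longrightarrow> p - q \<in> J"
    and "c \<in> carrier (polynomial_ring V) \<Longrightarrow> p \<in> J \<Longrightarrow> c * p \<in> J"
    and "p \<in> J \<Longrightarrow> p \<in> carrier (polynomial_ring V)"
    and "(\<And>i. i \<in> M \<Longrightarrow> f i \<in> J) \<Longrightarrow> sum f M \<in> J"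
proof -
  interpret J: ideal J "polynomial_ring V" by fact
  show z: "0 \<in> J" using additive_subgroup.zero_closed[OF J.additive_subgroup_axioms] by simp
  have a: "p + q \<in> J" if "p \<in> J" "q \<in> J" for p q
    using additive_subgroup.a_closed[OF J.additive_subgroup_axioms that] by simp
  have m: "c * p \<in> J" if "c \<in> carrier (polynomial_ring V)" "p \<in> J" for c p
    using J.I_l_closed[OF that(2,1)] by simp
  show "p \<in> J \<Longrightarrow> q \<in> J \<Longrightarrow> p + q \<in> J" by (rule a)
  show "c \<in> carrier (polynomial_ring V) \<Longrightarrow> p \<in> J \<Longrightarrow> c * p \<in> J" by (rule m)
  show "p - q \<in> J" if "p \<in> J" "q \<in> J"
    using a[OF that(1) m[OF _ that(2), of "- 1"]] by (auto simp: in_carrier_polynomial_ring)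
  show "p \<in> carrier (polynomial_ring V)" if "p \<in> J" using that J.Icarr by blast
  show "sum f M \<in> J" if "\<And>i. i \<in> M \<Longrightarrow> f i \<in> J"
    using that by (induction M rule: infinite_finite_induct) (auto intro: z a)
qed

lemma carrier_polynomial_ring_closed:
  fixes p q :: "('v, 'k::field) mpoly"
  assumes "p \<in> carrier (polynomial_ring V)"
  shows "q \<in> carrier (polynomial_ring V) \<Longrightarrow> p * q \<in> carrier (polynomial_ring V)"
    and "p ^ n \<in> carrier (polynomial_ring V)"
proof -
  interpret R: cring "polynomial_ring V :: ('v, 'k) mpoly ring" by (rule cring_polynomial_ring)
  have m: "p * q \<in> carrier (polynomial_ring V)"
    if "p \<in> carrier (polynomial_ring V)" "q \<in> carrier (polynomial_ring V)" for p q :: "('v, 'k) mpoly"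
    using R.m_closed[OF that] by simp
  show "p ^ n \<in> carrier (polynomial_ring V)"
    using m[OF assms] R.one_closed by (induction n) auto
  show "q \<in> carrier (polynomial_ring V) \<Longrightarrow> p * q \<in> carrier (polynomial_ring V)"
    by (rule m[OF assms])
qed

lemma sum_single_keys: "(\<Sum>m\<in>keys p. single m (lookup p m)) = p"
  by (rule poly_mapping_eqI)
    (auto simp: lookup_sum lookup_single when_def in_keys_iff sum.delta)

text \<open>The ideal generated by the variables in \<open>C \<inter> V\<close>, described by its
  monomials instead of by \<open>Idl\<close>, so that membership is read off term by term.
  \<open>variable_ideal_subset\<close> recovers the generators.\<close>

definition variable_ideal :: "'v set \<Rightarrow> 'v set \<Rightarrow> ('v, 'k::field) mpoly set" where
  "variable_ideal V C = {p \<in> carrier (polynomial_ring V). \<forall>m\<in>keys p. keys m \<inter> C \<noteq> {}}"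

lemma ideal_variable_ideal: "ideal (variable_ideal V C :: ('v, 'k::field) mpoly set) (polynomial_ring V)"
proof -
  interpret R: cring "polynomial_ring V :: ('v, 'k) mpoly ring" by (rule cring_polynomial_ring)
  show ?thesis
  proof (rule idealI)
    show "subgroup (variable_ideal V C) (add_monoid (polynomial_ring V :: ('v, 'k) mpoly ring))"
    proof (rule R.add.subgroupI)
      fix p :: "('v, 'k) mpoly"
      assume p: "p \<in> variable_ideal V C"
      then have "\<ominus>\<^bsub>polynomial_ring V\<^esub> p = - p"
        by (intro R.minus_equality) (auto simp: variable_ideal_def in_carrier_polynomial_ring in_keys_iff)
      then show "\<ominus>\<^bsub>polynomial_ring V\<^esub> p \<in> variable_ideal V C"
        using p by (simp add: variable_ideal_def in_carrier_polynomial_ring in_keys_iff)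
    next
      show "variable_ideal V C \<noteq> ({} :: ('v, 'k) mpoly set)"
        using R.zero_closed by (auto simp: variable_ideal_def intro!: exI[of _ 0])
    qed (auto simp: variable_ideal_def in_carrier_polynomial_ring dest!: keys_add_cases)
  next
    fix p c :: "('v, 'k) mpoly"
    assume p: "p \<in> variable_ideal V C" and c: "c \<in> carrier (polynomial_ring V)"
    then have "c * p \<in> carrier (polynomial_ring V)"
      by (simp add: variable_ideal_def carrier_polynomial_ring_closed)
    moreover have "keys m \<inter> C \<noteq> {}" if "m \<in> keys (c * p)" for m
      using that
    proof (rule keys_mult_elim)
      fix a b assume "b \<in> keys p" "m = a + b"
      then show ?thesis using p by (auto simp: variable_ideal_def keys_plus_nat)
    qed
    ultimately have "c * p \<in> variable_ideal V C" by (simp add: variable_ideal_def)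
    then show "c \<otimes>\<^bsub>polynomial_ring V\<^esub> p \<in> variable_ideal V C"
      and "p \<otimes>\<^bsub>polynomial_ring V\<^esub> c \<in> variable_ideal V C"
      by (simp_all add: mult.commute)
  qed (rule R.ring_axioms)
qed

lemma primeideal_variable_ideal:
  "primeideal (variable_ideal V C :: ('v::linorder, 'k::field) mpoly set) (polynomial_ring V)"
proof (rule primeidealI)
  let ?R = "polynomial_ring V :: ('v, 'k) mpoly ring" and ?P = "variable_ideal V C :: ('v, 'k) mpoly set"
  note P = in_ideal_polynomial_ring[OF ideal_variable_ideal]
  show "carrier ?R \<noteq> ?P"
  proof
    assume "carrier ?R = ?P"
    moreover have "1 \<in> carrier ?R" by (auto simp: in_carrier_polynomial_ring)
    ultimately have "1 \<in> ?P" by simp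
    then show False by (simp add: variable_ideal_def)
  qed
  have split: "\<exists>p0. p - p0 \<in> ?P \<and> p0 \<in> carrier ?R \<and> (\<forall>m\<in>keys p0. keys m \<inter> C = {})"
    if p: "p \<in> carrier ?R" for p
  proof -
    \<comment> \<open>Discarding the monomials that meet \<open>C\<close> gives a representative of
      \<open>p\<close> modulo the ideal that involves no variable of \<open>C\<close>.\<close>
    define p0 where "p0 = Poly_Mapping.mapp (\<lambda>m c. if keys m \<inter> C = {} then c else 0) p"
    have "lookup p0 m = (if keys m \<inter> C = {} then lookup p m else 0)" for m
      by (simp add: p0_def lookup_mapp when_def in_keys_iff)
    then have k: "keys p0 = {m \<in> keys p. keys m \<inter> C = {}}"
      "keys (p - p0) = {m \<in> keys p. keys m \<inter> C \<noteq> {}}"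
      unfolding set_eq_iff by (simp_all add: in_keys_iff lookup_minus del: not_in_keys_iff_lookup_eq_zero)
    have "p - p0 \<in> ?P" "p0 \<in> carrier ?R" "\<forall>m\<in>keys p0. keys m \<inter> C = {}"
      using p unfolding variable_ideal_def in_carrier_polynomial_ring mem_Collect_eq k by blast+
    then show ?thesis by blast
  qed
  fix p q
  assume p: "p \<in> carrier ?R" and q: "q \<in> carrier ?R" and pq: "p \<otimes>\<^bsub>?R\<^esub> q \<in> ?P"
  obtain p0 q0 where p0: "p - p0 \<in> ?P" "p0 \<in> carrier ?R" "\<forall>m\<in>keys p0. keys m \<inter> C = {}"
    and q0: "q - q0 \<in> ?P" "q0 \<in> carrier ?R" "\<forall>m\<in>keys q0. keys m \<inter> C = {}"
    using split[OF p] split[OF q] by metis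
  have "p0 * q0 = p * q - (q * (p - p0) + p0 * (q - q0))"
    by (simp add: algebra_simps)
  then have "p0 * q0 \<in> ?P"
    using pq by (simp add: P p0 q0 q)
  moreover have "keys m \<inter> C = {}" if "m \<in> keys (p0 * q0)" for m
    using that
  proof (rule keys_mult_elim)
    fix a b assume "a \<in> keys p0" "b \<in> keys q0" "m = a + b"
    then show ?thesis using p0(3) q0(3) by (simp add: keys_plus_nat Int_Un_distrib2)
  qed
  ultimately have "keys (p0 * q0) = {}"
    by (auto simp: variable_ideal_def)
  \<comment> \<open>The sort \<open>linorder\<close> enters here: ordering the monomials makes the
    polynomials a domain.\<close>
  then have "p0 = 0 \<or> q0 = 0" by simp
  then show "p \<in> ?P \<or> q \<in> ?P" using p0 q0 by auto
qed (rule ideal_variable_ideal cring_polynomial_ring)+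

lemma single_in_carrier:
  "keys m \<subseteq> V \<Longrightarrow> (single m c :: ('v, 'k::field) mpoly) \<in> carrier (polynomial_ring V)"
  by (auto simp: in_carrier_polynomial_ring)

lemma variable_in_carrier: "v \<in> V \<Longrightarrow> variable v \<in> carrier (polynomial_ring V)"
  unfolding variable_def by (rule single_in_carrier) auto

lemma variable_in_variable_ideal_iff:
  "(variable v :: ('v, 'k::field) mpoly) \<in> variable_ideal V C \<longleftrightarrow> v \<in> V \<inter> C"
  by (auto simp: variable_ideal_def variable_def in_carrier_polynomial_ring)

lemma prod_variable:
  assumes "finite e"
  shows "(\<Prod>v\<in>e. variable v :: ('v, 'k::field) mpoly) = single (\<Sum>v\<in>e. single v 1) 1"
  using assms by induction (auto simp: variable_def mult_single)

lemma keys_sum_single: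
  assumes "finite e"
  shows "keys (\<Sum>v\<in>e. single v (1::nat)) = e"
  using assms by induction (auto simp: keys_plus_nat)

lemma prod_variable_in_carrier:
  assumes "finite e" "e \<subseteq> V"
  shows "(\<Prod>v\<in>e. variable v :: ('v, 'k::field) mpoly) \<in> carrier (polynomial_ring V)"
  using assms by (simp add: prod_variable single_in_carrier keys_sum_single del: One_nat_def)

lemma prod_variable_in_variable_ideal_iff:
  assumes "finite e" "e \<subseteq> V"
  shows "(\<Prod>v\<in>e. variable v :: ('v, 'k::field) mpoly) \<in> variable_ideal V C \<longleftrightarrow> e \<inter> C \<noteq> {}"
  using assms
  by (simp add: prod_variable variable_ideal_def in_carrier_polynomial_ring keys_sum_single del: One_nat_def)

text \<open>The term is a multiple of the squarefree monomial of \<open>e\<close>. Applied with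
  \<open>e\<close> a single variable as well as with \<open>e\<close> an edge.\<close>

lemma single_in_ideal:
  fixes J :: "('v, 'k::field) mpoly set"
  assumes "ideal J (polynomial_ring V)" "(\<Prod>v\<in>e. variable v) \<in> J" "e \<subseteq> keys m" "keys m \<subseteq> V"
  shows "single m c \<in> J"
proof -
  have e: "finite e" using assms(3) finite_subset finite_keys by blast
  let ?s = "\<Sum>v\<in>e. single v (1::nat)"
  have le: "lookup ?s v \<le> lookup m v" for v
  proof -
    have "lookup ?s v = (if v \<in> e then 1 else 0)"
      using e by (simp add: lookup_sum lookup_single when_def)
    then show ?thesis using assms(3) by (auto simp: in_keys_iff Suc_le_eq)
  qed
  \<comment> \<open>Exponents are subtracted with truncation at zero; by \<open>le\<close> nothing
    is cut off.\<close>
  have m: "m = (m - ?s) + ?s"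
    using le by (intro poly_mapping_eqI) (simp add: lookup_add lookup_minus)
  have "keys (m - ?s) \<subseteq> V" using assms(4) by (auto simp: in_keys_iff lookup_minus)
  then have "single (m - ?s) c * (\<Prod>v\<in>e. variable v) \<in> J"
    by (intro in_ideal_polynomial_ring(4)[OF assms(1)] assms(2) single_in_carrier)
  moreover have "single m c = single (m - ?s) c * (\<Prod>v\<in>e. variable v)"
    by (subst m) (simp add: prod_variable e mult_single)
  ultimately show ?thesis by simp
qed

lemma variable_ideal_subset:
  fixes J :: "('v, 'k::field) mpoly set"
  assumes "ideal J (polynomial_ring V)" "\<And>v. v \<in> C \<inter> V \<Longrightarrow> variable v \<in> J"
  shows "variable_ideal V C \<subseteq> J"
proof
  fix p :: "('v, 'k) mpoly"
  assume p: "p \<in> variable_ideal V C"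
  have "single m (lookup p m) \<in> J" if "m \<in> keys p" for m
  proof -
    have "keys m \<inter> C \<noteq> {}" using p that by (simp add: variable_ideal_def)
    then obtain v where v: "v \<in> keys m" "v \<in> C" by blast
    have "keys m \<subseteq> V" using p that by (auto simp: variable_ideal_def in_carrier_polynomial_ring)
    then show ?thesis
      using v assms by (intro single_in_ideal[where e = "{v}", OF assms(1)]) auto
  qed
  then have "(\<Sum>m\<in>keys p. single m (lookup p m)) \<in> J"
    by (rule in_ideal_polynomial_ring(6)[OF assms(1)])
  then show "p \<in> J" by (simp add: sum_single_keys)
qed

section \<open>Dimension and height in polynomial rings\<close>

primrec power_product :: "'a::comm_ring_1 list \<Rightarrow> nat list \<Rightarrow> 'a" where
  "power_product [] es = 1"
| "power_product (y # ys) es = y ^ hd es * power_product ys (tl es)"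

lemma power_product_in_carrier:
  fixes ys :: "('v, 'k::field) mpoly list"
  assumes "set ys \<subseteq> carrier (polynomial_ring V)"
  shows "power_product ys es \<in> carrier (polynomial_ring V)"
  using assms
proof (induction ys arbitrary: es)
  case Nil
  then show ?case by (auto simp: in_carrier_polynomial_ring)
next
  case (Cons y ys)
  then show ?case by (auto intro!: carrier_polynomial_ring_closed)
qed

text \<open>Scalars act through constant polynomials. The same term is thus a ring product for the
  ideal lemmas and, by \<open>vector_space_scale\<close>, a scalar multiple for linear
  algebra.\<close>

abbreviation scale :: "'k::field \<Rightarrow> ('v, 'k) mpoly \<Rightarrow> ('v, 'k) mpoly" where
  "scale c p \<equiv> single 0 c * p"

lemma scale_in_carrier:
  fixes p :: "('v, 'k::field) mpoly"
  shows "p \<in> carrier (polynomial_ring V) \<Longrightarrow> scale c p \<in> carrier (polynomial_ring V)"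
  by (intro carrier_polynomial_ring_closed single_in_carrier) auto

lemma primeideal_polynomial_ring:
  fixes P :: "('v, 'k::field) mpoly set"
  assumes "primeideal P (polynomial_ring V)"
  shows "ideal P (polynomial_ring V)"
    and "p \<in> carrier (polynomial_ring V) \<Longrightarrow> q \<in> carrier (polynomial_ring V) \<Longrightarrow> p * q \<in> P
      \<Longrightarrow> p \<in> P \<or> q \<in> P"
    and "1 \<notin> P"
    and "p \<in> carrier (polynomial_ring V) \<Longrightarrow> p ^ n \<in> P \<Longrightarrow> p \<in> P"
proof -
  interpret P: primeideal P "polynomial_ring V" by fact
  show "ideal P (polynomial_ring V)" by (rule P.is_ideal)
  show *: "p \<in> P \<or> q \<in> P" if "p \<in> carrier (polynomial_ring V)" "q \<in> carrier (polynomial_ring V)"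
      "p * q \<in> P" for p q
    using P.I_prime[OF that(1,2)] that(3) by simp
  show 1: "1 \<notin> P" using P.one_imp_carrier P.I_notcarr by auto
  show "p \<in> P" if "p \<in> carrier (polynomial_ring V)" "p ^ n \<in> P"
    using that
  proof (induction n)
    case (Suc n)
    then show ?case using *[of p "p ^ n"] by (auto intro: carrier_polynomial_ring_closed)
  qed (use 1 in auto)
qed

text \<open>Elements chosen from the successive differences of a chain of primes are algebraically
  independent modulo its first member: divide a relation by the smallest power of the first
  element and pass to the next prime.\<close>

lemma chain_independent:
  fixes c :: "nat list \<Rightarrow> 'k::field" and ys :: "('v, 'k) mpoly list"
  assumes "prime_chain (polynomial_ring V) P (length ys)"
    and "\<And>i. i < length ys \<Longrightarrow> ys ! i \<in> P (Suc i) - P i"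
    and "finite M" "M \<noteq> {}" "\<And>es. es \<in> M \<Longrightarrow> length es = length ys" "\<And>es. es \<in> M \<Longrightarrow> c es \<noteq> 0"
  shows "(\<Sum>es\<in>M. scale (c es) (power_product ys es)) \<notin> P 0"
  using assms
proof (induction ys arbitrary: P M c)
  case Nil
  then have M: "M = {[]}" by auto
  have P0: "primeideal (P 0) (polynomial_ring V)" using Nil.prems(1) by (simp add: prime_chain_def)
  \<comment> \<open>A nonzero constant is a unit and lies in no prime.\<close>
  have "(1 :: ('v, 'k) mpoly) = scale (inverse (c [])) (scale (c []) 1)"
    using Nil.prems(6) M by (simp add: mult_single)
  then have "scale (c []) 1 \<notin> P 0"
    using in_ideal_polynomial_ring(4)[OF primeideal_polynomial_ring(1)[OF P0], of "single 0 (inverse (c []))" "scale (c []) 1"]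
      primeideal_polynomial_ring(3)[OF P0] single_in_carrier[of 0 V]
    by auto
  then show ?case using M by simp
next
  case (Cons y ys)
  let ?R = "polynomial_ring V :: ('v, 'k) mpoly ring"
  have prime: "primeideal (P i) ?R" if "i \<le> Suc (length ys)" for i
    using Cons.prems(1) that by (simp add: prime_chain_def)
  have prime01: "primeideal (P 0) ?R" "primeideal (P 1) ?R" by (auto intro: prime)
  note P0 = primeideal_polynomial_ring[OF prime01(1)]
  note P1 = primeideal_polynomial_ring[OF prime01(2)]
  have mono: "P 0 \<subseteq> P 1" using Cons.prems(1) by (auto simp: prime_chain_def)
  have y: "y \<in> P 1" "y \<notin> P 0" using Cons.prems(2)[of 0] by auto
  have yc: "y \<in> carrier ?R" using y(1) in_ideal_polynomial_ring(5)[OF P1(1)] by simp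
  have ysc: "set ys \<subseteq> carrier ?R"
  proof
    fix x assume "x \<in> set ys"
    then obtain i where "i < length ys" "x = ys ! i" by (auto simp: in_set_conv_nth)
    then show "x \<in> carrier ?R"
      using Cons.prems(2)[of "Suc i"]
        in_ideal_polynomial_ring(5)[OF primeideal_polynomial_ring(1)[OF prime[of "Suc (Suc i)"]]] by auto
  qed
  define k where "k = Min (hd ` M)"
  have k: "k \<le> hd es" if "es \<in> M" for es using that Cons.prems(3) by (simp add: k_def)
  have "k \<in> hd ` M" unfolding k_def using Cons.prems(3,4) by (intro Min_in) auto
  define M0 where "M0 = {es \<in> M. hd es = k}"
  have M0: "M0 \<noteq> {}" "finite M0" "M0 \<subseteq> M"
    using \<open>k \<in> hd ` M\<close> Cons.prems(3) by (auto simp: M0_def)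
  have form: "es = k # tl es" if "es \<in> M0" for es
    using that Cons.prems(5)[of es] by (cases es) (auto simp: M0_def)
  \<comment> \<open>All lists in \<open>M0\<close> share the head \<open>k\<close>, so passing to
    tails merges no two terms and every coefficient stays nonzero.\<close>
  have inj: "inj_on tl M0" by (rule inj_onI) (metis form)
  \<comment> \<open>The relation becomes \<open>y ^ k * (S + y * T)\<close>: \<open>S\<close>
    collects the terms with the lowest power of \<open>y\<close>, and \<open>T\<close> the others
    after splitting off \<open>y ^ (k + 1)\<close>.\<close>
  define S where "S = (\<Sum>es\<in>M0. scale (c es) (power_product ys (tl es)))"
  define T where "T = (\<Sum>es\<in>M - M0. scale (c es) (y ^ (hd es - k - 1) * power_product ys (tl es)))"
  have TC: "T \<in> carrier ?R"
    unfolding T_def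
    by (intro in_ideal_polynomial_ring(6)[OF ring.oneideal[OF cring.axioms(1)[OF cring_polynomial_ring]]]
        scale_in_carrier carrier_polynomial_ring_closed yc power_product_in_carrier ysc)
  have SC: "S \<in> carrier ?R"
    unfolding S_def
    by (intro in_ideal_polynomial_ring(6)[OF ring.oneideal[OF cring.axioms(1)[OF cring_polynomial_ring]]]
        scale_in_carrier power_product_in_carrier ysc)
  have S: "S \<notin> P 1"
  proof -
    have "(\<Sum>es\<in>tl ` M0. scale (c (k # es)) (power_product ys es)) \<notin> (P \<circ> Suc) 0"
    proof (rule Cons.IH)
      show "prime_chain ?R (P \<circ> Suc) (length ys)" using Cons.prems(1) by (simp add: prime_chain_def)
      show "ys ! i \<in> (P \<circ> Suc) (Suc i) - (P \<circ> Suc) i" if "i < length ys" for i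
        using Cons.prems(2)[of "Suc i"] that by simp
      show "length es = length ys" if "es \<in> tl ` M0" for es
        using that Cons.prems(5) M0(3) by auto
      show "c (k # es) \<noteq> 0" if "es \<in> tl ` M0" for es
        using that form Cons.prems(6) M0(3) by auto
    qed (use M0 in auto)
    also have "(\<Sum>es\<in>tl ` M0. scale (c (k # es)) (power_product ys es)) = S"
      unfolding S_def using form by (subst sum.reindex[OF inj]) (auto intro!: sum.cong)
    finally show ?thesis by simp
  qed
  show ?case
  proof
    assume "(\<Sum>es\<in>M. scale (c es) (power_product (y # ys) es)) \<in> P 0"
    also have "(\<Sum>es\<in>M. scale (c es) (power_product (y # ys) es))
      = (\<Sum>es\<in>M0. scale (c es) (power_product (y # ys) es))
        + (\<Sum>es\<in>M - M0. scale (c es) (power_product (y # ys) es))"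
      by (subst sum.subset_diff[OF M0(3) Cons.prems(3)]) (rule add.commute)
    also have "(\<Sum>es\<in>M0. scale (c es) (power_product (y # ys) es)) = y ^ k * S"
      unfolding S_def by (auto simp: sum_distrib_left M0_def ac_simps intro!: sum.cong)
    also have "(\<Sum>es\<in>M - M0. scale (c es) (power_product (y # ys) es)) = y ^ k * (y * T)"
      unfolding T_def sum_distrib_left
    proof (rule sum.cong[OF refl])
      fix es assume "es \<in> M - M0"
      then have "hd es = k + (1 + (hd es - k - 1))" using k[of es] by (auto simp: M0_def)
      then have "y ^ hd es = y ^ k * (y * y ^ (hd es - k - 1))"
        by (metis power_add power_one_right)
      then show "scale (c es) (power_product (y # ys) es)
        = y ^ k * (y * scale (c es) (y ^ (hd es - k - 1) * power_product ys (tl es)))"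
        by (simp add: ac_simps)
    qed
    also have "y ^ k * S + y ^ k * (y * T) = y ^ k * (S + y * T)" by (simp add: algebra_simps)
    finally have *: "y ^ k * (S + y * T) \<in> P 0" .
    have yT: "T * y \<in> P 1" by (rule in_ideal_polynomial_ring(4)[OF P1(1) TC y(1)])
    have "S + y * T \<in> carrier ?R"
      using in_ideal_polynomial_ring(2)[OF ring.oneideal[OF cring.axioms(1)[OF cring_polynomial_ring]]]
        SC TC yc carrier_polynomial_ring_closed(1) by blast
    \<comment> \<open>As \<open>y\<close> is outside the prime \<open>P 0\<close>, the factor
      \<open>y ^ k\<close> cancels. Modulo \<open>P 1\<close> the summand \<open>y * T\<close>
      disappears and only \<open>S\<close> is left.\<close>
    then have "S + y * T \<in> P 0"
      using P0(2)[OF carrier_polynomial_ring_closed(2)[OF yc] _ *] P0(4)[OF yc] y(2) by blast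
    then have "S + y * T - T * y \<in> P 1"
      using in_ideal_polynomial_ring(3)[OF P1(1)] yT mono by blast
    then show False using S by (simp add: mult.commute)
  qed
qed

text \<open>Bounding each exponent separately, not the total degree, makes the number of monomials
  the pure power \<open>(b + 1) ^ card V\<close> for finite \<open>V\<close>, which is easy to
  compare in \<open>box_count\<close>.\<close>

definition box_poly :: "'v set \<Rightarrow> nat \<Rightarrow> ('v, 'k::field) mpoly set" where
  "box_poly V b = {p. \<forall>m\<in>keys p. keys m \<subseteq> V \<and> (\<forall>v. lookup m v \<le> b)}"

lemma box_poly_mult:
  assumes "p \<in> box_poly V a" "q \<in> box_poly V b"
  shows "p * q \<in> box_poly V (a + b)"
  using assms unfolding box_poly_def
  by (fastforce elim!: keys_mult_elim simp: keys_plus_nat lookup_add intro: add_mono)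

lemma box_poly_one: "1 \<in> box_poly V b"
  by (auto simp: box_poly_def)

lemma box_poly_power:
  assumes "p \<in> box_poly V a"
  shows "p ^ n \<in> box_poly V (n * a)"
  using assms by (induction n) (auto intro: box_poly_mult box_poly_one)

lemma box_poly_mono: "a \<le> b \<Longrightarrow> box_poly V a \<subseteq> box_poly V b"
  unfolding box_poly_def using order_trans by blast

lemma box_poly_power_product:
  assumes "set ys \<subseteq> box_poly V a" "length es = length ys" "set es \<subseteq> {..D}"
  shows "power_product ys es \<in> box_poly V (length ys * (D * a))"
  using assms
proof (induction ys arbitrary: es)
  case (Cons y ys)
  then obtain e es' where es: "es = e # es'" by (cases es) auto
  have "y ^ e \<in> box_poly V (D * a)"
    using box_poly_power[of y V a e] box_poly_mono[of "e * a" "D * a" V] Cons.prems es by auto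
  then show ?case
    using box_poly_mult[OF _ Cons.IH[of es']] Cons.prems es by auto
qed (simp add: box_poly_one)

lemma carrier_subset_box_poly:
  fixes p :: "('v, 'k::field) mpoly"
  assumes "p \<in> carrier (polynomial_ring V)"
  shows "\<exists>b. p \<in> box_poly V b"
proof -
  define b where "b = (\<Sum>m\<in>keys p. \<Sum>v\<in>keys m. lookup m v)"
  have "lookup m v \<le> b" if "m \<in> keys p" for m v
  proof (cases "v \<in> keys m")
    case True
    then have "lookup m v \<le> (\<Sum>v\<in>keys m. lookup m v)" by (intro member_le_sum) auto
    also have "\<dots> \<le> b" unfolding b_def using that by (intro member_le_sum) auto
    finally show ?thesis .
  qed (simp add: in_keys_iff)
  then show ?thesis using assms by (auto simp: box_poly_def in_carrier_polynomial_ring)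
qed

lemma vector_space_scale: "vector_space (scale :: 'k::field \<Rightarrow> ('v, 'k) mpoly \<Rightarrow> ('v, 'k) mpoly)"
  by unfold_locales (auto simp: algebra_simps single_add mult_single simp flip: mult.assoc)

text \<open>The monomials of the box span it, and an independent set is no larger than a spanning
  set. Independence is phrased with nonzero coefficients on nonempty subsets because
  \<open>chain_independent\<close> delivers it in this form.\<close>

lemma box_poly_independent_bound:
  fixes S :: "('v, 'k::field) mpoly set"
  assumes "finite V" "finite S" "S \<subseteq> box_poly V b"
    and indep: "\<And>f T. T \<subseteq> S \<Longrightarrow> T \<noteq> {} \<Longrightarrow> (\<And>x. x \<in> T \<Longrightarrow> f x \<noteq> 0) \<Longrightarrow> (\<Sum>x\<in>T. scale (f x) x) \<noteq> 0"
  shows "card S \<le> (b + 1) ^ card V"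
proof -
  interpret vector_space "scale :: 'k \<Rightarrow> ('v, 'k) mpoly \<Rightarrow> _" by (rule vector_space_scale)
  define N where "N = {m :: 'v \<Rightarrow>\<^sub>0 nat. keys m \<subseteq> V \<and> (\<forall>v. lookup m v \<le> b)}"
  define T :: "('v, 'k) mpoly set" where "T = (\<lambda>m. single m 1) ` N"
  have inj: "inj_on (\<lambda>m. restrict (lookup m) V) N"
  proof (rule inj_onI, rule poly_mapping_eqI)
    fix m n v assume *: "m \<in> N" "n \<in> N" "restrict (lookup m) V = restrict (lookup n) V"
    show "lookup m v = lookup n v"
    proof (cases "v \<in> V")
      case True then show ?thesis using *(3) by (metis restrict_apply')
    next
      case False
      then show ?thesis using *(1,2) by (metis (no_types, lifting) N_def in_keys_iff mem_Collect_eq subsetD)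
    qed
  qed
  have sub: "(\<lambda>m. restrict (lookup m) V) ` N \<subseteq> PiE V (\<lambda>_. {..b})" by (auto simp: N_def)
  have fP: "finite (PiE V (\<lambda>_. {..b}))" using assms(1) by (intro finite_PiE) auto
  have finN: "finite N" using inj sub fP by (metis finite_imageD finite_subset)
  have "card N \<le> card (PiE V (\<lambda>_. {..b}))" by (rule card_inj_on_le[OF inj sub fP])
  also have "\<dots> = (b + 1) ^ card V" using assms(1) by (simp add: card_PiE)
  finally have cardT: "card T \<le> (b + 1) ^ card V"
    unfolding T_def using card_image_le[OF finN] order_trans by blast
  have "S \<subseteq> span T"
  proof
    fix p assume "p \<in> S"
    then have p: "p \<in> box_poly V b" using assms by auto
    have "single m (lookup p m) \<in> span T" if "m \<in> keys p" for m
    proof -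
      have "single m 1 \<in> T" using p that by (auto simp: T_def N_def box_poly_def)
      then have "scale (lookup p m) (single m 1) \<in> span T" by (intro span_scale span_base)
      then show ?thesis by (simp add: mult_single)
    qed
    then have "(\<Sum>m\<in>keys p. single m (lookup p m)) \<in> span T" by (rule span_sum)
    then show "p \<in> span T" by (simp add: sum_single_keys)
  qed
  moreover have "independent S"
    using \<open>finite S\<close>
  proof (rule independent_if_scalars_zero)
    fix f x assume sum: "(\<Sum>x\<in>S. scale (f x) x) = 0" and "x \<in> S"
    have "(\<Sum>x\<in>{x\<in>S. f x \<noteq> 0}. scale (f x) x) = (\<Sum>x\<in>S. scale (f x) x)"
      using \<open>finite S\<close> by (intro sum.mono_neutral_left) auto
    then have "{x\<in>S. f x \<noteq> 0} = {}" unfolding sum by (rule contrapos_pp) (rule indep, auto)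
    then show "f x = 0" using \<open>x \<in> S\<close> by auto
  qed
  ultimately have "card S \<le> card T"
    using independent_span_bound finN T_def by blast
  then show ?thesis using cardT by simp
qed

text \<open>In \<open>D\<close> the left side grows with exponent \<open>N\<close>, the right side
  with exponent \<open>n > N\<close>. The choice of \<open>D\<close> makes the constant factor
  \<open>(n * a + 1) ^ N\<close> equal to \<open>D\<close> itself, so one additional factor
  \<open>D + 1\<close> absorbs it.\<close>

lemma box_count:
  fixes n N a :: nat
  assumes "N < n"
  defines "D \<equiv> (n * a + 1) ^ N"
  shows "(n * (D * a) + 1) ^ N < (D + 1) ^ n"
proof -
  have "(n * (D * a) + 1) ^ N \<le> ((n * a + 1) * (D + 1)) ^ N"
    by (rule power_mono) (auto simp: algebra_simps)
  also have "\<dots> = D * (D + 1) ^ N" by (simp only: D_def power_mult_distrib)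
  also have "\<dots> < (D + 1) * (D + 1) ^ N" by (simp del: power_Suc)
  also have "\<dots> = (D + 1) ^ Suc N" by simp
  also have "\<dots> \<le> (D + 1) ^ n" using assms(1) by (intro power_increasing) auto
  finally show ?thesis .
qed

text \<open>Pick one element from each gap of the chain. The \<open>(D + 1) ^ n\<close> products of
  their powers with exponents up to \<open>D\<close> are independent, yet for a chain that is too
  long they lie in a box with fewer monomials.\<close>

lemma prime_chain_length_le:
  fixes P :: "nat \<Rightarrow> ('v, 'k::field) mpoly set"
  assumes "finite V" and P: "prime_chain (polynomial_ring V) P n"
  shows "n \<le> card V"
proof (rule ccontr)
  assume "\<not> n \<le> card V"
  then have n: "card V < n" by simp
  have "\<exists>y. y \<in> P (Suc i) - P i" if "i < n" for i using P that by (auto simp: prime_chain_def)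
  then obtain y where y: "\<And>i. i < n \<Longrightarrow> y i \<in> P (Suc i) - P i" by metis
  have "\<exists>b. y i \<in> box_poly V b" if "i < n" for i
  proof -
    have "primeideal (P (Suc i)) (polynomial_ring V)" using P that by (simp add: prime_chain_def)
    then show ?thesis
      using y[OF that] in_ideal_polynomial_ring(5)[OF primeideal_polynomial_ring(1)]
      by (intro carrier_subset_box_poly) blast
  qed
  then obtain b where b: "\<And>i. i < n \<Longrightarrow> y i \<in> box_poly V (b i)" by metis
  define a where "a = (\<Sum>i<n. b i)"
  define ys where "ys = map y [0..<n]"
  have len: "length ys = n" by (simp add: ys_def)
  have ys: "set ys \<subseteq> box_poly V a"
  proof
    fix x assume "x \<in> set ys"
    then obtain i where i: "i < n" "x = y i" by (auto simp: ys_def)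
    have "b i \<le> a" unfolding a_def using i by (intro member_le_sum) auto
    then show "x \<in> box_poly V a" using b[OF i(1)] i(2) box_poly_mono by blast
  qed
  define D where "D = (n * a + 1) ^ card V"
  define L where "L = {es :: nat list. set es \<subseteq> {..D} \<and> length es = n}"
  have L: "finite L" "card L = (D + 1) ^ n"
    unfolding L_def by (simp_all add: finite_lists_length_eq card_lists_length_eq)
  have key: "(\<Sum>es\<in>M. scale (c es) (power_product ys es)) \<noteq> 0"
    if "M \<subseteq> L" "M \<noteq> {}" "\<And>es. es \<in> M \<Longrightarrow> c es \<noteq> 0" for M c
  proof -
    have "(\<Sum>es\<in>M. scale (c es) (power_product ys es)) \<notin> P 0"
    proof (rule chain_independent)
      show "prime_chain (polynomial_ring V) P (length ys)" using P len by simp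
      show "ys ! i \<in> P (Suc i) - P i" if "i < length ys" for i using y that by (simp add: ys_def)
    qed (use that L len in \<open>auto simp: L_def intro: finite_subset\<close>)
    moreover have "0 \<in> P 0"
      using P in_ideal_polynomial_ring(1)[OF primeideal_polynomial_ring(1)] by (auto simp: prime_chain_def)
    ultimately show ?thesis by metis
  qed
  \<comment> \<open>Two equal products would satisfy a relation with coefficients 1 and -1.\<close>
  have inj: "inj_on (power_product ys) L"
  proof (rule inj_onI, rule ccontr)
    fix es fs assume *: "es \<in> L" "fs \<in> L" "power_product ys es = power_product ys fs" "es \<noteq> fs"
    have "(\<Sum>x\<in>{es, fs}. scale (if x = es then 1 else - 1) (power_product ys x)) \<noteq> 0"
      by (rule key) (use * in \<open>auto split: if_splits\<close>)
    then show False using * by (simp add: single_uminus)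
  qed
  have "card (power_product ys ` L) \<le> (n * (D * a) + 1) ^ card V"
  proof (rule box_poly_independent_bound)
    show "power_product ys ` L \<subseteq> box_poly V (n * (D * a))"
      using box_poly_power_product[OF ys, of _ D] len by (auto simp: L_def)
    fix f :: "('v, 'k) mpoly \<Rightarrow> 'k" and T
    assume T: "T \<subseteq> power_product ys ` L" "T \<noteq> {}" "\<And>x. x \<in> T \<Longrightarrow> f x \<noteq> 0"
    then obtain M where M: "M \<subseteq> L" "T = power_product ys ` M" by (auto simp: subset_image_iff)
    then have "inj_on (power_product ys) M" using inj inj_on_subset by blast
    then show "(\<Sum>x\<in>T. scale (f x) x) \<noteq> 0"
      using key[of M "\<lambda>es. f (power_product ys es)"] T M by (auto simp: sum.reindex)
  qed (use assms L in auto)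
  then have "(D + 1) ^ n \<le> (n * (D * a) + 1) ^ card V"
    using L inj by (simp add: card_image)
  then show False using box_count[OF n, of a] by (simp add: D_def)
qed

section \<open>Heights of ideals of variables and of edge ideals\<close>

lemma variable_ideal_strict_mono:
  assumes "C \<subseteq> D" "v \<in> D - C" "v \<in> V"
  shows "variable_ideal V C \<subset> (variable_ideal V D :: ('v, 'k::field) mpoly set)"
proof -
  have "variable v \<in> (variable_ideal V D :: ('v, 'k) mpoly set)"
    "variable v \<notin> (variable_ideal V C :: ('v, 'k) mpoly set)"
    using assms by (auto simp: variable_in_variable_ideal_iff)
  moreover have "variable_ideal V C \<subseteq> (variable_ideal V D :: ('v, 'k) mpoly set)"
    using assms by (auto simp: variable_ideal_def)
  ultimately show ?thesis by blast
qed

text \<open>A chain ending in a variable ideal extends through all larger variable ideals, so the bound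
  on the dimension bounds its height.\<close>

lemma prime_chain_variable_ideal_le:
  fixes P :: "nat \<Rightarrow> ('v::linorder, 'k::field) mpoly set"
  assumes "finite V" "C \<subseteq> V" "prime_chain (polynomial_ring V) P n" "P n = variable_ideal V C"
  shows "n \<le> card C"
  using assms(2-)
proof (induction "card (V - C)" arbitrary: C P n)
  case 0
  then have "C = V" using assms(1) by auto
  then show ?case using prime_chain_length_le[OF assms(1) 0(3)] by simp
next
  case (Suc k)
  then have "V - C \<noteq> {}" by auto
  then obtain v where v: "v \<in> V" "v \<notin> C" by blast
  let ?P = "P(Suc n := variable_ideal V (insert v C))"
  have lt: "P n \<subset> variable_ideal V (insert v C)"
    unfolding Suc.prems(3) using v by (intro variable_ideal_strict_mono) auto
  have "prime_chain (polynomial_ring V) ?P (Suc n)"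
    using Suc.prems(2) lt primeideal_variable_ideal[of V "insert v C", where ?'k = 'k]
    by (auto simp: prime_chain_def le_Suc_eq less_Suc_eq)
  moreover have "k = card (V - insert v C)"
  proof -
    have "V - insert v C = (V - C) - {v}" by auto
    then show ?thesis using Suc.hyps(2) v assms(1) by simp
  qed
  ultimately have "Suc n \<le> card (insert v C)"
    using Suc.hyps(1)[of "insert v C" ?P "Suc n"] v Suc.prems(1) by auto
  moreover have "finite C" using assms(1) Suc.prems(1) finite_subset by blast
  ultimately show ?case using v by simp
qed

lemma edge_ideal_subset:
  fixes J :: "('v, 'k::field) mpoly set"
  assumes "ideal J (polynomial_ring V)" "\<And>e. e \<in> E \<Longrightarrow> (\<Prod>v\<in>e. variable v) \<in> J"
  shows "edge_ideal V E \<subseteq> J"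
  unfolding edge_ideal_def
  by (rule ring.genideal_minimal[OF cring.axioms(1)[OF cring_polynomial_ring] assms(1)])
    (use assms(2) in auto)

lemma
  fixes V :: "'v set"
  assumes "clutter V E"
  shows ideal_edge_ideal: "ideal (edge_ideal V E :: ('v, 'k::field) mpoly set) (polynomial_ring V)"
    and edge_in_edge_ideal: "e \<in> E \<Longrightarrow> (\<Prod>v\<in>e. variable v) \<in> (edge_ideal V E :: ('v, 'k) mpoly set)"
proof -
  interpret R: cring "polynomial_ring V :: ('v, 'k) mpoly ring" by (rule cring_polynomial_ring)
  have sub: "{\<Prod>v\<in>e. variable v | e. e \<in> E} \<subseteq> carrier (polynomial_ring V :: ('v, 'k) mpoly ring)"
  proof safe
    fix e assume "e \<in> E"
    then have "e \<subseteq> V" "finite e" using assms by (auto simp: clutter_def intro: finite_subset)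
    then show "(\<Prod>v\<in>e. variable v) \<in> carrier (polynomial_ring V :: ('v, 'k) mpoly ring)"
      using prod_variable_in_carrier by blast
  qed
  show "ideal (edge_ideal V E :: ('v, 'k) mpoly set) (polynomial_ring V)"
    unfolding edge_ideal_def by (rule R.genideal_ideal[OF sub])
  show "(\<Prod>v\<in>e. variable v) \<in> (edge_ideal V E :: ('v, 'k) mpoly set)" if "e \<in> E"
    unfolding edge_ideal_def using R.genideal_self[OF sub] that by blast
qed

lemma edge_ideal_subset_variable_ideal:
  assumes "clutter V E" "vertex_cover V E C"
  shows "edge_ideal V E \<subseteq> (variable_ideal V C :: ('v, 'k::field) mpoly set)"
proof (rule edge_ideal_subset[OF ideal_variable_ideal])
  fix e assume "e \<in> E"
  then have e: "e \<subseteq> V" "C \<inter> e \<noteq> {}" "finite V"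
    using assms by (auto simp: clutter_def vertex_cover_def)
  moreover have "finite e" using e finite_subset by blast
  ultimately show "(\<Prod>v\<in>e. variable v) \<in> (variable_ideal V C :: ('v, 'k) mpoly set)"
    using prod_variable_in_variable_ideal_iff by blast
qed

lemma prod_in_prime:
  fixes p :: "('v, 'k::field) mpoly set"
  assumes "primeideal p (polynomial_ring V)" "finite e" "e \<subseteq> V" "(\<Prod>v\<in>e. variable v) \<in> p"
  shows "\<exists>v\<in>e. variable v \<in> p"
  using assms(2-)
proof induction
  case empty
  then show ?case using primeideal_polynomial_ring(3)[OF assms(1)] by simp
next
  case (insert v e)
  then show ?case
    using primeideal_polynomial_ring(2)[OF assms(1), of "variable v" "\<Prod>v\<in>e. variable v"]
    by (auto simp: variable_in_carrier prod_variable_in_carrier)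
qed

text \<open>Adjoining the variables of \<open>C\<close> one at a time gives a strict chain of
  variable ideals inside \<open>p\<close>. Its last member is replaced by \<open>p\<close>, which
  may be larger.\<close>

lemma prime_height_ge:
  fixes p :: "('v::linorder, 'k::field) mpoly set"
  assumes "primeideal p (polynomial_ring V)" "finite C" "C \<subseteq> V" "\<And>v. v \<in> C \<Longrightarrow> variable v \<in> p"
  shows "enat (card C) \<le> prime_height (polynomial_ring V) p"
proof -
  obtain xs where xs: "set xs = C" "distinct xs" using finite_distinct_list assms(2) by blast
  define n where "n = length xs"
  have n: "n = card C" unfolding n_def using xs distinct_card by metis
  define P where "P i = (if i < n then variable_ideal V (set (take i xs)) else p)" for i
  have "P i \<subset> P (Suc i)" if "i < n" for i
  proof (cases "Suc i < n")
    case True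
    have notin: "xs ! i \<notin> set (take i xs)"
      using xs(2) that by (auto simp: in_set_conv_nth n_def distinct_conv_nth)
    have "xs ! i \<in> V" using that xs(1) assms(3) by (auto simp: n_def)
    then have "variable_ideal V (set (take i xs))
        \<subset> (variable_ideal V (set (take (Suc i) xs)) :: ('v, 'k) mpoly set)"
      using that notin
      by (intro variable_ideal_strict_mono[where v = "xs ! i"])
        (auto simp: take_Suc_conv_app_nth n_def)
    then show ?thesis using True by (simp add: P_def)
  next
    case False
    then have i: "n = Suc i" using that by simp
    have "xs ! i \<in> C" using xs that n_def by (metis nth_mem)
    moreover have "xs ! i \<notin> set (take i xs)"
      using xs(2) that by (auto simp: in_set_conv_nth n_def distinct_conv_nth)
    moreover have "variable_ideal V (set (take i xs)) \<subseteq> p"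
      using assms xs(1) set_take_subset[of i xs]
      by (intro variable_ideal_subset primeideal_polynomial_ring(1)) auto
    ultimately show ?thesis
      using assms(4)[of "xs ! i"] i by (auto simp: P_def variable_in_variable_ideal_iff)
  qed
  then have "prime_chain (polynomial_ring V) P n"
    using assms(1) primeideal_variable_ideal[of V, where ?'k = 'k] by (auto simp: prime_chain_def P_def)
  moreover have "P n = p" by (simp add: P_def)
  ultimately show ?thesis
    unfolding prime_height_def n by (intro Sup_upper) blast
qed

text \<open>The cover \<open>C\<close> yields a prime of height at most \<open>g\<close> above the
  edge ideal. Conversely, a prime above the edge ideal contains a variable from every edge, so its
  variables form a cover, and \<open>prime_height_ge\<close> applies.\<close>

lemma edge_ideal_height_eq:
  fixes V :: "'v::linorder set"
  assumes "clutter V E" "vertex_cover V E C" "card C = g"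
    and min: "\<And>D. vertex_cover V E D \<Longrightarrow> g \<le> card D"
  shows "edge_ideal_height TYPE('k::field) V E = enat g"
proof (rule antisym)
  let ?R = "polynomial_ring V :: ('v, 'k) mpoly ring" and ?I = "edge_ideal V E :: ('v, 'k) mpoly set"
  have V: "finite V" using assms(1) by (simp add: clutter_def)
  have C: "C \<subseteq> V" using assms(2) by (simp add: vertex_cover_def)
  have "prime_height ?R (variable_ideal V C) \<le> enat g"
    unfolding prime_height_def
    using prime_chain_variable_ideal_le[OF V C] assms(3) by (intro Sup_least) auto
  moreover have "edge_ideal_height TYPE('k) V E \<le> prime_height ?R (variable_ideal V C)"
    unfolding edge_ideal_height_def ideal_height_def
    using primeideal_variable_ideal edge_ideal_subset_variable_ideal[OF assms(1,2)]
    by (intro Inf_lower) blast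
  ultimately show "edge_ideal_height TYPE('k) V E \<le> enat g" by simp
  show "enat g \<le> edge_ideal_height TYPE('k) V E"
    unfolding edge_ideal_height_def ideal_height_def
  proof (rule Inf_greatest, safe)
    fix p assume p: "primeideal p ?R" "?I \<subseteq> p"
    define D where "D = {v \<in> V. variable v \<in> p}"
    have "D \<inter> e \<noteq> {}" if "e \<in> E" for e
    proof -
      have "e \<subseteq> V" "finite e" using assms(1) that by (auto simp: clutter_def intro: finite_subset)
      then show ?thesis
        using prod_in_prime[OF p(1), of e] edge_in_edge_ideal[OF assms(1) that, where ?'k = 'k] p(2)
        by (auto simp: D_def)
    qed
    then have "g \<le> card D" by (intro min) (auto simp: vertex_cover_def D_def)
    moreover have "enat (card D) \<le> prime_height ?R p"
      using V by (intro prime_height_ge[OF p(1)]) (auto simp: D_def)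
    ultimately show "enat g \<le> prime_height ?R p" by (metis enat_ord_simps(1) order_trans)
  qed
qed

section \<open>Localization and depth\<close>

locale prime_localization = primeideal p R for p and R (structure)
begin

definition denominators where "denominators = carrier R - p"

abbreviation local_ring where "local_ring \<equiv> localization R denominators"

definition frac where "frac a s = frac_rel R denominators `` {(a, s)}"

lemma denominators_carrier: "s \<in> denominators \<Longrightarrow> s \<in> carrier R"
  by (simp add: denominators_def)

lemma denominators_mult: "s \<in> denominators \<Longrightarrow> t \<in> denominators \<Longrightarrow> s \<otimes> t \<in> denominators"
  using I_prime by (auto simp: denominators_def)

lemma one_denominators: "\<one> \<in> denominators"
  using one_imp_carrier I_notcarr by (auto simp: denominators_def)

lemmas denominators_intros = denominators_carrier denominators_mult one_denominators

text \<open>Free of subtraction, so equality of fractions becomes an identity that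
  \<open>m_ac\<close> can settle.\<close>

lemma frac_rel_iff:
  "((a, s), (b, t)) \<in> frac_rel R denominators \<longleftrightarrow>
    a \<in> carrier R \<and> b \<in> carrier R \<and> s \<in> denominators \<and> t \<in> denominators \<and>
    (\<exists>u\<in>denominators. u \<otimes> (a \<otimes> t) = u \<otimes> (b \<otimes> s))"
proof -
  have "u \<otimes> (x \<ominus> y) = \<zero> \<longleftrightarrow> u \<otimes> x = u \<otimes> y"
    if "u \<in> carrier R" "x \<in> carrier R" "y \<in> carrier R" for u x y
    using that by (metis m_closed r_right_minus_eq r_distr a_minus_def r_minus a_inv_closed)
  then show ?thesis
    by (auto simp: frac_rel_def denominators_intros)
qed

lemma equiv_frac_rel: "equiv (carrier R \<times> denominators) (frac_rel R denominators)"
proof (rule equivI)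
  show "frac_rel R denominators \<subseteq> (carrier R \<times> denominators) \<times> (carrier R \<times> denominators)"
    by (auto simp: frac_rel_def)
  show "refl_on (carrier R \<times> denominators) (frac_rel R denominators)"
    by (rule refl_onI) (auto simp: frac_rel_iff intro: one_denominators)
  show "sym (frac_rel R denominators)"
    by (rule symI) (clarsimp simp: frac_rel_iff, metis)
  show "trans (frac_rel R denominators)"
  proof (rule transI, clarsimp simp: frac_rel_iff)
    fix a s b t c w u v
    assume cl: "a \<in> carrier R" "b \<in> carrier R" "c \<in> carrier R" "s \<in> denominators"
      "t \<in> denominators" "w \<in> denominators" "u \<in> denominators" "v \<in> denominators"
      and u: "u \<otimes> (a \<otimes> t) = u \<otimes> (b \<otimes> s)" and v: "v \<otimes> (b \<otimes> w) = v \<otimes> (c \<otimes> t)"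
    note cl' = cl denominators_carrier[OF cl(4)] denominators_carrier[OF cl(5)]
      denominators_carrier[OF cl(6)] denominators_carrier[OF cl(7)] denominators_carrier[OF cl(8)]
    have "(u \<otimes> v \<otimes> t) \<otimes> (a \<otimes> w) = (v \<otimes> w) \<otimes> (u \<otimes> (a \<otimes> t))"
      using cl' by (simp add: m_ac)
    also have "\<dots> = (u \<otimes> s) \<otimes> (v \<otimes> (b \<otimes> w))"
      unfolding u using cl' by (simp add: m_ac)
    also have "\<dots> = (u \<otimes> v \<otimes> t) \<otimes> (c \<otimes> s)"
      unfolding v using cl' by (simp add: m_ac)
    finally show "\<exists>u\<in>denominators. u \<otimes> (a \<otimes> w) = u \<otimes> (c \<otimes> s)"
      using cl by (intro bexI[of _ "u \<otimes> v \<otimes> t"]) (auto intro: denominators_mult)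
  qed
qed

lemma frac_eq_iff:
  assumes "a \<in> carrier R" "s \<in> denominators" "b \<in> carrier R" "t \<in> denominators"
  shows "frac a s = frac b t \<longleftrightarrow> (\<exists>u\<in>denominators. u \<otimes> (a \<otimes> t) = u \<otimes> (b \<otimes> s))"
  unfolding frac_def using assms
  by (subst eq_equiv_class_iff[OF equiv_frac_rel]) (auto simp: frac_rel_iff)

lemma in_frac_iff:
  assumes "a \<in> carrier R" "s \<in> denominators"
  shows "(b, t) \<in> frac a s \<longleftrightarrow> b \<in> carrier R \<and> t \<in> denominators \<and> frac b t = frac a s"
proof -
  have "(b, t) \<in> frac a s \<longleftrightarrow> ((a, s), (b, t)) \<in> frac_rel R denominators" by (simp add: frac_def)
  then show ?thesis
    using assms frac_eq_iff[OF assms, of b t] unfolding frac_rel_iff by metis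
qed

lemma carrier_local_ring: "X \<in> carrier local_ring \<longleftrightarrow> (\<exists>a\<in>carrier R. \<exists>s\<in>denominators. X = frac a s)"
  by (auto simp: localization_def quotient_def frac_def)

lemma frac_in_carrier: "a \<in> carrier R \<Longrightarrow> s \<in> denominators \<Longrightarrow> frac a s \<in> carrier local_ring"
  unfolding carrier_local_ring by blast

lemma one_local_ring: "\<one>\<^bsub>local_ring\<^esub> = frac \<one> \<one>"
  and zero_local_ring: "\<zero>\<^bsub>local_ring\<^esub> = frac \<zero> \<one>"
  by (simp_all add: localization_def frac_def)

text \<open>The operations of \<open>localization\<close> are unions over all representatives; once
  the value does not depend on the choice, the union collapses to it.\<close>

lemma UN_frac:
  assumes "a \<in> carrier R" "s \<in> denominators" "b \<in> carrier R" "t \<in> denominators"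
    and "\<And>a' s' b' t'. a' \<in> carrier R \<Longrightarrow> s' \<in> denominators \<Longrightarrow> b' \<in> carrier R \<Longrightarrow> t' \<in> denominators
      \<Longrightarrow> frac a' s' = frac a s \<Longrightarrow> frac b' t' = frac b t \<Longrightarrow> f a' s' b' t' = f a s b t"
  shows "(\<Union>(a', s')\<in>frac a s. \<Union>(b', t')\<in>frac b t. f a' s' b' t') = f a s b t"
proof -
  have ne: "(a, s) \<in> frac a s" "(b, t) \<in> frac b t" using assms by (simp_all add: in_frac_iff)
  have "(\<Union>(b', t')\<in>frac b t. f a' s' b' t') = f a s b t" if as: "(a', s') \<in> frac a s" for a' s'
  proof -
    have "f a' s' b' t' = f a s b t" if bt: "(b', t') \<in> frac b t" for b' t'
      using as[unfolded in_frac_iff[OF assms(1,2)]] bt[unfolded in_frac_iff[OF assms(3,4)]]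
      by (intro assms(5)) blast+
    then show ?thesis using ne(2) by (intro SUP_eq_const) auto
  qed
  then have "(case x of (a', s') \<Rightarrow> \<Union>(b', t')\<in>frac b t. f a' s' b' t') = f a s b t"
    if "x \<in> frac a s" for x
    using that by (simp only: case_prod_unfold prod.collapse)
  then show ?thesis using ne(1) by (intro SUP_eq_const) blast+
qed

lemma frac_mult:
  assumes "a \<in> carrier R" "s \<in> denominators" "b \<in> carrier R" "t \<in> denominators"
  shows "frac a s \<otimes>\<^bsub>local_ring\<^esub> frac b t = frac (a \<otimes> b) (s \<otimes> t)"
proof -
  have "frac a s \<otimes>\<^bsub>local_ring\<^esub> frac b t
    = (\<Union>(a', s')\<in>frac a s. \<Union>(b', t')\<in>frac b t. frac (a' \<otimes> b') (s' \<otimes> t'))"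
    by (simp add: localization_def frac_def)
  also have "\<dots> = frac (a \<otimes> b) (s \<otimes> t)"
  proof (rule UN_frac[OF assms])
    fix a' s' b' t'
    assume cl: "a' \<in> carrier R" "s' \<in> denominators" "b' \<in> carrier R" "t' \<in> denominators"
      and "frac a' s' = frac a s" "frac b' t' = frac b t"
    then obtain u v where uv: "u \<in> denominators" "v \<in> denominators"
      and u: "u \<otimes> (a' \<otimes> s) = u \<otimes> (a \<otimes> s')" and v: "v \<otimes> (b' \<otimes> t) = v \<otimes> (b \<otimes> t')"
      using assms by (auto simp: frac_eq_iff)
    note c = assms cl uv assms(2,4)[THEN denominators_carrier] cl(2,4)[THEN denominators_carrier]
      uv[THEN denominators_carrier]
    have "(u \<otimes> v) \<otimes> ((a' \<otimes> b') \<otimes> (s \<otimes> t)) = (u \<otimes> (a' \<otimes> s)) \<otimes> (v \<otimes> (b' \<otimes> t))"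
      using c by (simp add: m_ac)
    also have "\<dots> = (u \<otimes> v) \<otimes> ((a \<otimes> b) \<otimes> (s' \<otimes> t'))"
      unfolding u v using c by (simp add: m_ac)
    finally show "frac (a' \<otimes> b') (s' \<otimes> t') = frac (a \<otimes> b) (s \<otimes> t)"
      using c denominators_mult by (subst frac_eq_iff) blast+
  qed
  finally show ?thesis .
qed

lemma frac_add:
  assumes "a \<in> carrier R" "s \<in> denominators" "b \<in> carrier R" "t \<in> denominators"
  shows "frac a s \<oplus>\<^bsub>local_ring\<^esub> frac b t = frac (a \<otimes> t \<oplus> b \<otimes> s) (s \<otimes> t)"
proof -
  have "frac a s \<oplus>\<^bsub>local_ring\<^esub> frac b t
    = (\<Union>(a', s')\<in>frac a s. \<Union>(b', t')\<in>frac b t. frac (a' \<otimes> t' \<oplus> b' \<otimes> s') (s' \<otimes> t'))"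
    by (simp add: localization_def frac_def)
  also have "\<dots> = frac (a \<otimes> t \<oplus> b \<otimes> s) (s \<otimes> t)"
  proof (rule UN_frac[OF assms])
    fix a' s' b' t'
    assume cl: "a' \<in> carrier R" "s' \<in> denominators" "b' \<in> carrier R" "t' \<in> denominators"
      and "frac a' s' = frac a s" "frac b' t' = frac b t"
    then obtain u v where uv: "u \<in> denominators" "v \<in> denominators"
      and u: "u \<otimes> (a' \<otimes> s) = u \<otimes> (a \<otimes> s')" and v: "v \<otimes> (b' \<otimes> t) = v \<otimes> (b \<otimes> t')"
      using assms by (auto simp: frac_eq_iff)
    note c = assms cl uv assms(2,4)[THEN denominators_carrier] cl(2,4)[THEN denominators_carrier]
      uv[THEN denominators_carrier]
    have "(u \<otimes> v) \<otimes> ((a' \<otimes> t' \<oplus> b' \<otimes> s') \<otimes> (s \<otimes> t))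
      = (u \<otimes> (a' \<otimes> s)) \<otimes> (v \<otimes> t \<otimes> t') \<oplus> (v \<otimes> (b' \<otimes> t)) \<otimes> (u \<otimes> s \<otimes> s')"
      using c by (simp add: m_ac l_distr r_distr)
    also have "\<dots> = (u \<otimes> v) \<otimes> ((a \<otimes> t \<oplus> b \<otimes> s) \<otimes> (s' \<otimes> t'))"
      unfolding u v using c by (simp add: m_ac l_distr r_distr)
    finally show "frac (a' \<otimes> t' \<oplus> b' \<otimes> s') (s' \<otimes> t') = frac (a \<otimes> t \<oplus> b \<otimes> s) (s \<otimes> t)"
      using c denominators_mult by (subst frac_eq_iff) (blast intro: m_closed a_closed)+
  qed
  finally show ?thesis .
qed

lemma frac_eq_zero_iff:
  assumes "a \<in> carrier R" "s \<in> denominators"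
  shows "frac a s = \<zero>\<^bsub>local_ring\<^esub> \<longleftrightarrow> (\<exists>u\<in>denominators. u \<otimes> a = \<zero>)"
  unfolding zero_local_ring
  using assms denominators_intros by (subst frac_eq_iff) auto

definition extension where
  "extension Q = {frac a s | a s. a \<in> Q \<and> s \<in> denominators}"

text \<open>Since \<open>Q\<close> lies in \<open>p\<close>, no denominator is in \<open>Q\<close>,
  and primality cancels the factor \<open>u \<otimes> t\<close>. Membership therefore depends on no
  choice of representative, and strict inclusions of primes survive extension.\<close>

lemma frac_in_extension_iff:
  assumes "primeideal Q R" "Q \<subseteq> p" "a \<in> carrier R" "s \<in> denominators"
  shows "frac a s \<in> extension Q \<longleftrightarrow> a \<in> Q"
proof
  interpret Q: primeideal Q R by fact
  assume "frac a s \<in> extension Q"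
  then obtain b t where b: "b \<in> Q" "t \<in> denominators" "frac a s = frac b t"
    by (auto simp: extension_def)
  then obtain u where u: "u \<in> denominators" "u \<otimes> (a \<otimes> t) = u \<otimes> (b \<otimes> s)"
    using assms Q.Icarr by (auto simp: frac_eq_iff)
  have "u \<otimes> (b \<otimes> s) \<in> Q"
    using b u assms denominators_carrier by (simp add: Q.I_l_closed Q.I_r_closed)
  then have "(u \<otimes> t) \<otimes> a \<in> Q"
    using u b assms denominators_carrier by (simp add: m_ac)
  moreover have "u \<otimes> t \<in> denominators" using u b denominators_mult by simp
  ultimately show "a \<in> Q"
    using Q.I_prime[of "u \<otimes> t" a] assms by (auto simp: denominators_def)
qed (use assms in \<open>auto simp: extension_def\<close>)

text \<open>\<open>cring local_ring\<close> is a hypothesis because the application obtains it from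
  the Cohen-Macaulay property that is to be refuted.\<close>

lemma primeideal_extension:
  assumes "primeideal Q R" "Q \<subseteq> p" "cring local_ring"
  shows "primeideal (extension Q) local_ring"
proof -
  interpret Q: primeideal Q R by fact
  interpret L: cring local_ring by fact
  have carr: "extension Q \<subseteq> carrier local_ring"
    using Q.Icarr by (auto simp: extension_def intro: frac_in_carrier)
  have mult: "x \<otimes>\<^bsub>local_ring\<^esub> y \<in> extension Q"
    if x: "x \<in> carrier local_ring" and y: "y \<in> extension Q" for x y
  proof -
    obtain a s where "a \<in> carrier R" "s \<in> denominators" "x = frac a s" using x carrier_local_ring by auto
    moreover obtain b t where "b \<in> Q" "t \<in> denominators" "y = frac b t" using y by (auto simp: extension_def)
    ultimately have "x \<otimes>\<^bsub>local_ring\<^esub> y = frac (a \<otimes> b) (s \<otimes> t)" "a \<otimes> b \<in> Q" "s \<otimes> t \<in> denominators"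
      using Q.Icarr by (simp_all add: frac_mult Q.I_l_closed denominators_mult)
    then show ?thesis unfolding extension_def by blast
  qed
  have add: "x \<oplus>\<^bsub>local_ring\<^esub> y \<in> extension Q" if x: "x \<in> extension Q" and y: "y \<in> extension Q" for x y
  proof -
    obtain a s where a: "a \<in> Q" "s \<in> denominators" "x = frac a s" using x by (auto simp: extension_def)
    obtain b t where b: "b \<in> Q" "t \<in> denominators" "y = frac b t" using y by (auto simp: extension_def)
    have "a \<otimes> t \<oplus> b \<otimes> s \<in> Q"
      using a b denominators_carrier
      by (intro additive_subgroup.a_closed[OF Q.additive_subgroup_axioms] Q.I_r_closed) auto
    then show ?thesis
      using a b Q.Icarr denominators_mult by (auto simp: frac_add extension_def)
  qed
  show ?thesis
  proof (rule primeidealI)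
    show "ideal (extension Q) local_ring"
    proof (rule idealI)
      show "subgroup (extension Q) (add_monoid local_ring)"
      proof (rule L.add.subgroupI)
        show "extension Q \<noteq> {}"
          using additive_subgroup.zero_closed[OF Q.additive_subgroup_axioms] one_denominators
          unfolding extension_def by blast
        fix x assume x: "x \<in> extension Q"
        then have "\<ominus>\<^bsub>local_ring\<^esub> x = (\<ominus>\<^bsub>local_ring\<^esub> \<one>\<^bsub>local_ring\<^esub>) \<otimes>\<^bsub>local_ring\<^esub> x"
          using carr by (auto simp: L.l_minus)
        then show "\<ominus>\<^bsub>local_ring\<^esub> x \<in> extension Q" using mult x by simp
      qed (use carr add in auto)
      show "y \<otimes>\<^bsub>local_ring\<^esub> x \<in> extension Q"
        if "x \<in> carrier local_ring" "y \<in> extension Q" for x y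
        using mult[OF that] L.m_comm[of x y] that carr by auto
    qed (use mult in \<open>auto intro: L.ring_axioms\<close>)
    have "frac \<one> \<one> \<notin> extension Q"
      using assms one_denominators Q.one_imp_carrier Q.I_notcarr by (subst frac_in_extension_iff) auto
    then show "carrier local_ring \<noteq> extension Q"
      using frac_in_carrier one_denominators by blast
    fix x y
    assume "x \<in> carrier local_ring" "y \<in> carrier local_ring" and xy: "x \<otimes>\<^bsub>local_ring\<^esub> y \<in> extension Q"
    then obtain a s b t where ab: "a \<in> carrier R" "s \<in> denominators" "x = frac a s"
      "b \<in> carrier R" "t \<in> denominators" "y = frac b t"
      by (auto simp: carrier_local_ring)
    then have "a \<otimes> b \<in> Q"
      using xy assms denominators_mult by (simp add: frac_mult frac_in_extension_iff)
    then show "x \<in> extension Q \<or> y \<in> extension Q"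
      using Q.I_prime[of a b] ab by (auto simp: extension_def)
  qed (rule assms(3))
qed

text \<open>A fraction with numerator outside \<open>p\<close> is a unit. The inclusion gives every
  element of a sequence in \<open>m\<close> a numerator in \<open>p\<close>.\<close>

lemma maximalideal_subset_extension:
  assumes "maximalideal m local_ring"
  shows "m \<subseteq> extension p"
proof
  interpret m: maximalideal m local_ring by fact
  fix x assume x: "x \<in> m"
  then obtain a s where a: "a \<in> carrier R" "s \<in> denominators" "x = frac a s"
    using m.Icarr carrier_local_ring by blast
  show "x \<in> extension p"
  proof (rule ccontr)
    assume "x \<notin> extension p"
    then have "a \<notin> p" using a(2,3) unfolding extension_def by blast
    then have d: "a \<in> denominators" using a(1) by (simp add: denominators_def)
    have "frac s a \<otimes>\<^bsub>local_ring\<^esub> x \<in> m"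
      using x a d frac_in_carrier denominators_carrier by (intro m.I_l_closed) auto
    also have "frac s a \<otimes>\<^bsub>local_ring\<^esub> x = frac (s \<otimes> a) (a \<otimes> s)"
      using a d by (simp add: frac_mult denominators_carrier)
    also have "\<dots> = \<one>\<^bsub>local_ring\<^esub>"
      unfolding one_local_ring using a d one_denominators denominators_mult denominators_carrier
      by (subst frac_eq_iff) (auto simp: m_comm)
    finally show False using m.one_imp_carrier m.I_notcarr by auto
  qed
qed

text \<open>Write \<open>a = a\<^sub>1 + a\<^sub>2\<close> with \<open>a\<^sub>i \<in> P\<^sub>i\<close>. Locally \<open>P\<^sub>1 \<inter> P\<^sub>2\<close> vanishes, so \<open>a\<^sub>1 b = a b\<^sub>1\<close> lies in
  \<open>(a)\<close> for every \<open>b \<in> p\<close>, while \<open>a\<^sub>1\<close> lies in \<open>(a)\<close> only if \<open>a\<close> is a zero divisor.\<close>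

lemma regular_sequence_length_le_one:
  assumes L: "cring local_ring"
    and P: "primeideal P1 R" "primeideal P2 R" "P1 \<subseteq> p" "P2 \<subseteq> p" "\<not> P1 \<subseteq> P2" "\<not> P2 \<subseteq> P1"
    and sum: "\<And>x. x \<in> p \<Longrightarrow> \<exists>y\<in>P1. \<exists>z\<in>P2. x = y \<oplus> z"
    and u: "u \<in> denominators" "\<And>z. z \<in> P1 \<inter> P2 \<Longrightarrow> u \<otimes> z = \<zero>"
    and xs: "regular_sequence local_ring xs" "set xs \<subseteq> extension p"
  shows "length xs \<le> 1"
proof (rule ccontr)
  interpret L: cring local_ring by fact
  interpret P1: primeideal P1 R by fact
  interpret P2: primeideal P2 R by fact
  note dc = denominators_carrier
  assume "\<not> length xs \<le> 1"
  then obtain x y ys where xy: "xs = x # y # ys"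
    by (metis One_nat_def le_numeral_extra(4) length_Cons list.exhaust list.size(3) zero_le)
  obtain a s where a: "a \<in> p" "s \<in> denominators" "x = frac a s" using xs(2) xy by (auto simp: extension_def)
  obtain b t where b: "b \<in> p" "t \<in> denominators" "y = frac b t" using xs(2) xy by (auto simp: extension_def)
  have ac: "a \<in> carrier R" "b \<in> carrier R" using a b Icarr by auto
  have xc: "x \<in> carrier local_ring" using a ac frac_in_carrier by auto
  have reg: "c \<in> Idl\<^bsub>local_ring\<^esub> (set (take i xs))"
    if "i < length xs" "c \<in> carrier local_ring"
      "c \<otimes>\<^bsub>local_ring\<^esub> (xs ! i) \<in> Idl\<^bsub>local_ring\<^esub> (set (take i xs))" for i c
    using xs(1) that unfolding regular_sequence_def by blast
  \<comment> \<open>Regularity of the first element \<open>x\<close>: the empty prefix generates the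
    zero ideal, so whatever \<open>a\<close> annihilates locally vanishes locally.\<close>
  have kill: "\<exists>v\<in>denominators. v \<otimes> c = \<zero>"
    if c: "c \<in> carrier R" and w: "w \<in> denominators" "w \<otimes> (c \<otimes> a) = \<zero>" for c w
  proof -
    have "{} \<subseteq> {\<zero>\<^bsub>local_ring\<^esub>}" by simp
    then have Idl: "Idl\<^bsub>local_ring\<^esub> {} = {\<zero>\<^bsub>local_ring\<^esub>}"
      using L.genideal_minimal[OF L.zeroideal] L.genideal_ideal[of "{}"]
        additive_subgroup.zero_closed[OF ideal.axioms(1)] by blast
    have "frac c \<one> \<otimes>\<^bsub>local_ring\<^esub> x = frac (c \<otimes> a) (\<one> \<otimes> s)"
      using c a ac one_denominators by (simp add: frac_mult)
    also have "\<dots> = \<zero>\<^bsub>local_ring\<^esub>"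
      using c a ac one_denominators denominators_mult w by (subst frac_eq_zero_iff) auto
    finally have "frac c \<one> \<otimes>\<^bsub>local_ring\<^esub> (xs ! 0) \<in> Idl\<^bsub>local_ring\<^esub> (set (take 0 xs))"
      using Idl xy by simp
    then have "frac c \<one> \<in> Idl\<^bsub>local_ring\<^esub> (set (take 0 xs))"
      using reg[of 0] c one_denominators frac_in_carrier xy by simp
    then show ?thesis using Idl c one_denominators by (simp add: frac_eq_zero_iff)
  qed
  obtain a1 a2 where a12: "a1 \<in> P1" "a2 \<in> P2" "a = a1 \<oplus> a2" using sum a(1) by blast
  obtain b1 b2 where b12: "b1 \<in> P1" "b2 \<in> P2" "b = b1 \<oplus> b2" using sum b(1) by blast
  note carr = ac a12(1) a12(2) b12(1) b12(2) P1.Icarr[OF a12(1)] P2.Icarr[OF a12(2)]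
    P1.Icarr[OF b12(1)] P2.Icarr[OF b12(2)] dc[OF a(2)] dc[OF b(2)] dc[OF u(1)]
  have u0: "u \<otimes> (c \<otimes> d) = \<zero>" if "c \<in> P1" "d \<in> P2" for c d
    using that by (intro u(2)) (simp add: P1.I_r_closed P2.I_l_closed P1.Icarr P2.Icarr)
  have zero_in: "\<zero> \<in> P1" "\<zero> \<in> P2"
    using additive_subgroup.zero_closed[OF P1.additive_subgroup_axioms]
      additive_subgroup.zero_closed[OF P2.additive_subgroup_axioms] by auto
  \<comment> \<open>If \<open>a1\<close> vanished locally, \<open>a\<close> would act as
    \<open>a2\<close> and annihilate any \<open>c\<close> in \<open>P1\<close> outside
    \<open>P2\<close>. A denominator killing \<open>c\<close> would then lie in \<open>P2\<close>,
    hence in \<open>p\<close>.\<close>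
  have not1: "w \<otimes> a1 \<noteq> \<zero>" if w: "w \<in> denominators" for w
  proof
    assume w0: "w \<otimes> a1 = \<zero>"
    obtain c where c: "c \<in> P1" "c \<notin> P2" using P(5) by blast
    have cc: "c \<in> carrier R" using c P1.Icarr by simp
    have "(u \<otimes> w) \<otimes> (c \<otimes> a) = (u \<otimes> c) \<otimes> (w \<otimes> a1) \<oplus> w \<otimes> (u \<otimes> (c \<otimes> a2))"
      using carr cc dc[OF w] by (simp add: a12(3) r_distr m_ac)
    also have "\<dots> = \<zero>" using w0 u0[OF c(1) a12(2)] carr cc dc[OF w] by simp
    finally obtain v where v: "v \<in> denominators" "v \<otimes> c = \<zero>"
      using kill[OF cc denominators_mult[OF u(1) w]] by blast
    then have "v \<in> P2" using P2.I_prime[OF dc[OF v(1)] cc] zero_in c by auto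
    then show False using v P(4) by (auto simp: denominators_def)
  qed
  have not2: "w \<otimes> a2 \<noteq> \<zero>" if w: "w \<in> denominators" for w
  proof
    assume w0: "w \<otimes> a2 = \<zero>"
    obtain c where c: "c \<in> P2" "c \<notin> P1" using P(6) by blast
    have cc: "c \<in> carrier R" using c P2.Icarr by simp
    have "(u \<otimes> w) \<otimes> (c \<otimes> a) = w \<otimes> (u \<otimes> (a1 \<otimes> c)) \<oplus> (u \<otimes> c) \<otimes> (w \<otimes> a2)"
      using carr cc dc[OF w] by (simp add: a12(3) r_distr m_ac)
    also have "\<dots> = \<zero>" using w0 u0[OF a12(1) c(1)] carr cc dc[OF w] by simp
    finally obtain v where v: "v \<in> denominators" "v \<otimes> c = \<zero>"
      using kill[OF cc denominators_mult[OF u(1) w]] by blast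
    then have "v \<in> P1" using P1.I_prime[OF dc[OF v(1)] cc] zero_in c by auto
    then show False using v P(3) by (auto simp: denominators_def)
  qed
  have "frac a1 \<one> \<otimes>\<^bsub>local_ring\<^esub> y = frac (b1 \<otimes> s) t \<otimes>\<^bsub>local_ring\<^esub> x"
  proof -
    have "frac a1 \<one> \<otimes>\<^bsub>local_ring\<^esub> y = frac (a1 \<otimes> b) (\<one> \<otimes> t)"
      using carr b one_denominators by (simp add: frac_mult)
    moreover have "frac (b1 \<otimes> s) t \<otimes>\<^bsub>local_ring\<^esub> x = frac (b1 \<otimes> s \<otimes> a) (t \<otimes> s)"
      using carr a b by (simp add: frac_mult)
    moreover have "u \<otimes> (a1 \<otimes> b \<otimes> (t \<otimes> s)) = u \<otimes> (b1 \<otimes> s \<otimes> a \<otimes> (\<one> \<otimes> t))"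
    proof -
      have "u \<otimes> (a1 \<otimes> b \<otimes> (t \<otimes> s)) = u \<otimes> (a1 \<otimes> b1) \<otimes> (t \<otimes> s) \<oplus> u \<otimes> (a1 \<otimes> b2) \<otimes> (t \<otimes> s)"
        using carr by (simp add: b12(3) r_distr l_distr m_ac)
      \<comment> \<open>Both mixed products lie in \<open>P1 \<inter> P2\<close> and are killed by
        \<open>u\<close>, so one may replace the other; this completes
        \<open>b1 \<otimes> a1\<close> to \<open>b1 \<otimes> a\<close>.\<close>
      also have "\<dots> = u \<otimes> (a1 \<otimes> b1) \<otimes> (t \<otimes> s) \<oplus> u \<otimes> (b1 \<otimes> a2) \<otimes> (t \<otimes> s)"
        using u0[OF a12(1) b12(2)] u0[OF b12(1) a12(2)] by simp
      also have "\<dots> = u \<otimes> (b1 \<otimes> s \<otimes> a \<otimes> (\<one> \<otimes> t))"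
        using carr by (simp add: a12(3) r_distr l_distr m_ac)
      finally show ?thesis .
    qed
    ultimately show ?thesis
      using carr a b one_denominators denominators_mult u(1)
      by (simp add: frac_eq_iff) blast
  qed
  then have "frac a1 \<one> \<otimes>\<^bsub>local_ring\<^esub> y \<in> PIdl\<^bsub>local_ring\<^esub> x"
    using carr b frac_in_carrier by (auto simp: cgenideal_def)
  then have "frac a1 \<one> \<otimes>\<^bsub>local_ring\<^esub> (xs ! 1) \<in> Idl\<^bsub>local_ring\<^esub> (set (take 1 xs))"
    using xy L.cgenideal_eq_genideal[OF xc] by simp
  then have "frac a1 \<one> \<in> Idl\<^bsub>local_ring\<^esub> (set (take 1 xs))"
    using reg[of 1] carr one_denominators frac_in_carrier xy by simp
  then have "frac a1 \<one> \<in> PIdl\<^bsub>local_ring\<^esub> x"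
    using xy L.cgenideal_eq_genideal[OF xc] by simp
  then obtain c w where c: "c \<in> carrier R" "w \<in> denominators"
    and "frac a1 \<one> = frac c w \<otimes>\<^bsub>local_ring\<^esub> x"
    by (auto simp: cgenideal_def carrier_local_ring)
  then have "frac a1 \<one> = frac (c \<otimes> a) (w \<otimes> s)" using a ac by (simp add: frac_mult)
  then obtain v where v: "v \<in> denominators" "v \<otimes> (a1 \<otimes> (w \<otimes> s)) = v \<otimes> (c \<otimes> a \<otimes> \<one>)"
    using carr a c one_denominators denominators_mult by (auto simp: frac_eq_iff)
  have vc: "v \<in> carrier R" "w \<in> carrier R" using v c dc by auto
  \<comment> \<open>Splitting \<open>a\<close> in the relation \<open>v\<close> makes a multiple of
    \<open>a1\<close> equal to a multiple of \<open>a2\<close>. Their common value \<open>z\<close>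
    lies in \<open>P1 \<inter> P2\<close>, so \<open>u\<close> kills it.\<close>
  define z where "z = v \<otimes> c \<otimes> a2"
  have z2: "z \<in> P2" using carr vc c by (simp add: z_def P2.I_l_closed)
  have eq: "v \<otimes> (w \<otimes> s \<ominus> c) \<otimes> a1 = z"
  proof -
    have cancel: "y = x \<oplus> y \<ominus> x" if "x \<in> carrier R" "y \<in> carrier R" for x y
      using that by (simp add: a_minus_def a_comm[of x y] a_assoc r_neg)
    have "v \<otimes> (a1 \<otimes> (w \<otimes> s)) = v \<otimes> (c \<otimes> a1) \<oplus> z"
      using v(2) carr vc c by (simp add: z_def a12(3) r_distr m_ac)
    then have "z = v \<otimes> (a1 \<otimes> (w \<otimes> s)) \<ominus> v \<otimes> (c \<otimes> a1)"
      using carr vc c cancel[of "v \<otimes> (c \<otimes> a1)" z] by (simp add: z_def)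
    also have "\<dots> = v \<otimes> (w \<otimes> s \<ominus> c) \<otimes> a1"
      using carr vc c by (simp add: a_minus_def l_distr r_distr l_minus r_minus m_ac)
    finally show ?thesis by simp
  qed
  have z1: "z \<in> P1"
    unfolding eq[symmetric] using carr vc c by (simp add: P1.I_l_closed)
  have uz: "u \<otimes> z = \<zero>" using z1 z2 u(2) by simp
  \<comment> \<open>The local dichotomy between \<open>c\<close> and its complement: if
    \<open>c\<close> is outside \<open>p\<close>, then \<open>a2\<close> vanishes locally; if
    \<open>c\<close> is in \<open>p\<close>, then \<open>w \<otimes> s \<ominus> c\<close> is a
    denominator and \<open>a1\<close> vanishes locally.\<close>
  show False
  proof (cases "c \<in> p")
    case False
    then have "c \<in> denominators" using c by (simp add: denominators_def)
    then have "u \<otimes> (v \<otimes> c) \<in> denominators" using u(1) v(1) by (intro denominators_mult)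
    moreover have "u \<otimes> (v \<otimes> c) \<otimes> a2 = \<zero>" using uz carr vc c by (simp add: z_def m_assoc)
    ultimately show False using not2 by blast
  next
    case True
    have "w \<otimes> s \<ominus> c \<notin> p"
    proof
      assume "w \<otimes> s \<ominus> c \<in> p"
      then have "(w \<otimes> s \<ominus> c) \<oplus> c \<in> p"
        using True additive_subgroup.a_closed[OF additive_subgroup_axioms] by blast
      then have "w \<otimes> s \<in> p" using carr vc c by (simp add: a_minus_def a_assoc l_neg)
      then show False using denominators_mult[OF c(2) a(2)] by (simp add: denominators_def)
    qed
    then have "w \<otimes> s \<ominus> c \<in> denominators" using carr vc c by (simp add: denominators_def)
    then have "u \<otimes> (v \<otimes> (w \<otimes> s \<ominus> c)) \<in> denominators" using u v denominators_mult by simp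
    moreover have "u \<otimes> (v \<otimes> (w \<otimes> s \<ominus> c)) \<otimes> a1 = \<zero>"
      using uz eq carr vc c by (simp add: m_assoc)
    ultimately show False using not1 by blast
  qed
qed

end

text \<open>Locally \<open>P1 \<inter> P2\<close> is zero, as witnessed by the single element
  \<open>u\<close>, and the sum of both primes is the maximal ideal; so the spectrum is a union of
  two closed sets that meet only in the closed point. This caps the depth at one, while
  \<open>P1\<close>, \<open>Q\<close>, \<open>p\<close> force dimension at least two.\<close>

lemma not_cohen_macaulay_if_disconnected:
  fixes R (structure)
  assumes P: "primeideal p R" "primeideal P1 R" "primeideal P2 R" "primeideal Q R"
    and incl: "P1 \<subset> Q" "Q \<subset> p" "P2 \<subseteq> p" "\<not> P1 \<subseteq> P2" "\<not> P2 \<subseteq> P1"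
    and sum: "\<And>x. x \<in> p \<Longrightarrow> \<exists>y\<in>P1. \<exists>z\<in>P2. x = y \<oplus> z"
    and u: "u \<in> carrier R" "u \<notin> p" "\<And>z. z \<in> P1 \<inter> P2 \<Longrightarrow> u \<otimes> z = \<zero>"
  shows "\<not> cohen_macaulay R"
proof
  assume "cohen_macaulay R"
  interpret primeideal p R by fact
  interpret prime_localization p R by unfold_locales
  have "cohen_macaulay_local local_ring"
    using \<open>cohen_macaulay R\<close> P(1) by (simp add: cohen_macaulay_def denominators_def)
  then obtain m where L: "cring local_ring" and m: "maximalideal m local_ring"
    and depth: "depth local_ring m = krull_dim local_ring"
    by (auto simp: cohen_macaulay_local_def)
  have "depth local_ring m \<le> 1"
    unfolding depth_def
  proof (rule Sup_least, safe)
    fix xs assume xs: "set xs \<subseteq> m" "regular_sequence local_ring xs"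
    have "length xs \<le> 1"
    proof (rule regular_sequence_length_le_one[OF L P(2,3)])
      show "set xs \<subseteq> extension p" using xs maximalideal_subset_extension[OF m] by blast
    qed (use incl sum u xs in \<open>auto simp: denominators_def\<close>)
    then show "enat (length xs) \<le> 1" by (simp add: one_enat_def)
  qed
  moreover have "enat 2 \<le> krull_dim local_ring"
  proof -
    have strict: "extension A \<subset> extension B"
      if AB: "A \<subset> B" "B \<subseteq> p" "primeideal A R" "primeideal B R" for A B
    proof -
      obtain b where b: "b \<in> B" "b \<notin> A" using AB by blast
      then have bc: "b \<in> carrier R" using AB Icarr by blast
      have "frac b \<one> \<in> extension B" "frac b \<one> \<notin> extension A"
        using AB b bc one_denominators by (simp_all add: frac_in_extension_iff)
      moreover have "extension A \<subseteq> extension B" using AB by (auto simp: extension_def)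
      ultimately show ?thesis by blast
    qed
    let ?C = "\<lambda>i::nat. extension (if i = 0 then P1 else if i = 1 then Q else p)"
    have "prime_chain local_ring ?C 2"
      using incl P strict primeideal_extension[OF _ _ L]
      by (auto simp: prime_chain_def less_2_cases_iff)
    then show ?thesis
      unfolding krull_dim_def by (intro Sup_upper) blast
  qed
  ultimately show False
    unfolding depth by (metis one_enat_def enat_ord_simps(1) order_trans not_one_le_zero numeral_le_one_iff semiring_norm(69))
qed

section \<open>Passage to the residue class ring\<close>

lemma coset_in_image_iff:
  fixes R (structure)
  assumes "ideal I R" "ideal P R" "I \<subseteq> P" "x \<in> carrier R"
  shows "I +> x \<in> (+>) I ` P \<longleftrightarrow> x \<in> P"
proof
  interpret I: ideal I R by fact
  interpret P: ideal P R by fact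
  assume "I +> x \<in> (+>) I ` P"
  then obtain y where y: "y \<in> P" "I +> x = I +> y" by blast
  have "x \<in> I +> x" using I.a_rcos_self assms(4) by simp
  then obtain i where "i \<in> I" "x = i \<oplus> y" using y by (auto simp: a_r_coset_def')
  then show "x \<in> P" using y assms(3) additive_subgroup.a_closed[OF P.additive_subgroup_axioms] by blast
qed auto

lemma primeideal_quotient:
  fixes R (structure)
  assumes "cring R" "ideal I R" "primeideal P R" "I \<subseteq> P"
  shows "primeideal ((+>) I ` P) (R Quot I)"
proof -
  interpret cring R by fact
  interpret I: ideal I R by fact
  interpret P: primeideal P R by fact
  interpret h: ring_hom_ring R "R Quot I" "(+>) I" by (rule I.rcos_ring_hom_ring)
  have surj: "\<exists>a\<in>carrier R. x = I +> a" if "x \<in> carrier (R Quot I)" for x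
    using that unfolding FactRing_def A_RCOSETS_def'[of R I] by auto
  note iff = coset_in_image_iff[OF assms(2) P.is_ideal assms(4)]
  show ?thesis
  proof (rule primeidealI)
    show "ideal ((+>) I ` P) (R Quot I)"
      by (rule ring_ideal_imp_quot_ideal[OF assms(2) P.is_ideal])
    show "cring (R Quot I)" by (rule I.quotient_is_cring[OF assms(1)])
    have "I +> \<one> \<notin> (+>) I ` P" unfolding iff[OF one_closed] using P.one_imp_carrier P.I_notcarr by auto
    then show "carrier (R Quot I) \<noteq> (+>) I ` P" using h.hom_closed[OF one_closed] by metis
    fix x y assume xy: "x \<in> carrier (R Quot I)" "y \<in> carrier (R Quot I)" "x \<otimes>\<^bsub>R Quot I\<^esub> y \<in> (+>) I ` P"
    obtain a b where ab: "a \<in> carrier R" "b \<in> carrier R" "x = I +> a" "y = I +> b"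
      using surj[OF xy(1)] surj[OF xy(2)] by auto
    then have "I +> (a \<otimes> b) \<in> (+>) I ` P" using xy by simp
    then show "x \<in> (+>) I ` P \<or> y \<in> (+>) I ` P"
      using iff[of "a \<otimes> b"] ab P.I_prime[of a b] by auto
  qed
qed

text \<open>Moves the criterion up to \<open>R\<close>, where the primes can be ideals of variables
  and vanishing becomes membership in \<open>I\<close>. Inclusions can be tested before taking
  cosets because all the primes contain \<open>I\<close>.\<close>

lemma not_cohen_macaulay_quotient:
  fixes R (structure)
  assumes R: "cring R" "ideal I R"
    and P: "primeideal p R" "primeideal P1 R" "primeideal P2 R" "primeideal Q R"
    and incl: "I \<subseteq> P1" "I \<subseteq> P2" "P1 \<subset> Q" "Q \<subset> p" "P2 \<subseteq> p" "\<not> P1 \<subseteq> P2" "\<not> P2 \<subseteq> P1"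
    and sum: "\<And>x. x \<in> p \<Longrightarrow> \<exists>y\<in>P1. \<exists>z\<in>P2. x = y \<oplus> z"
    and u: "u \<in> carrier R" "u \<notin> p" "\<And>z. z \<in> P1 \<inter> P2 \<Longrightarrow> u \<otimes> z \<in> I"
  shows "\<not> cohen_macaulay (R Quot I)"
proof -
  interpret cring R by fact
  interpret I: ideal I R by fact
  interpret h: ring_hom_ring R "R Quot I" "(+>) I" by (rule I.rcos_ring_hom_ring)
  have sub: "I \<subseteq> P1" "I \<subseteq> P2" "I \<subseteq> Q" "I \<subseteq> p" using incl by auto
  note ideals = P[THEN primeideal.axioms(1)]
  have carr: "P1 \<subseteq> carrier R" "P2 \<subseteq> carrier R" "Q \<subseteq> carrier R" "p \<subseteq> carrier R"
    using ideals additive_subgroup.a_subset[OF ideal.axioms(1)] by blast+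
  have mono_iff: "(+>) I ` A \<subseteq> (+>) I ` B \<longleftrightarrow> A \<subseteq> B"
    if "ideal B R" "I \<subseteq> B" "A \<subseteq> carrier R" for A B
  proof
    assume img: "(+>) I ` A \<subseteq> (+>) I ` B"
    show "A \<subseteq> B"
    proof
      fix a assume "a \<in> A"
      then have "I +> a \<in> (+>) I ` B" "a \<in> carrier R" using img that(3) by blast+
      then show "a \<in> B" using coset_in_image_iff[OF R(2) that(1,2)] by simp
    qed
  qed (rule image_mono)
  show ?thesis
  proof (rule not_cohen_macaulay_if_disconnected)
    show "primeideal ((+>) I ` p) (R Quot I)" "primeideal ((+>) I ` P1) (R Quot I)"
      "primeideal ((+>) I ` P2) (R Quot I)" "primeideal ((+>) I ` Q) (R Quot I)"
      using P sub by (auto intro: primeideal_quotient[OF R])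
    show "(+>) I ` P1 \<subset> (+>) I ` Q" "(+>) I ` Q \<subset> (+>) I ` p" "(+>) I ` P2 \<subseteq> (+>) I ` p"
      "\<not> (+>) I ` P1 \<subseteq> (+>) I ` P2" "\<not> (+>) I ` P2 \<subseteq> (+>) I ` P1"
      using incl sub ideals carr by (simp_all add: less_le_not_le mono_iff)
    show "I +> u \<in> carrier (R Quot I)" using u(1) by simp
    show "I +> u \<notin> (+>) I ` p"
      using coset_in_image_iff[OF R(2) ideals(1) sub(4) u(1)] u(2) by simp
    show "\<exists>y\<in>(+>) I ` P1. \<exists>z\<in>(+>) I ` P2. x = y \<oplus>\<^bsub>R Quot I\<^esub> z" if x: "x \<in> (+>) I ` p" for x
    proof -
      obtain a where a: "a \<in> p" "x = I +> a" using x by blast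
      then obtain y z where yz: "y \<in> P1" "z \<in> P2" "a = y \<oplus> z" using sum by blast
      then have "x = (I +> y) \<oplus>\<^bsub>R Quot I\<^esub> (I +> z)"
        using a carr by (simp add: subsetD)
      then show ?thesis using yz by blast
    qed
    show "(I +> u) \<otimes>\<^bsub>R Quot I\<^esub> x = \<zero>\<^bsub>R Quot I\<^esub>" if x: "x \<in> (+>) I ` P1 \<inter> (+>) I ` P2" for x
    proof -
      obtain z where z: "z \<in> P1" "x = I +> z" using x by blast
      then have zc: "z \<in> carrier R" using carr by blast
      then have "z \<in> P2" using x z coset_in_image_iff[OF R(2) ideals(3) sub(2)] by auto
      then have "u \<otimes> z \<in> I" using u(3) z by blast
      then have "I +> (u \<otimes> z) = I" by (rule I.a_rcos_const)
      moreover have "\<zero>\<^bsub>R Quot I\<^esub> = I" by (simp only: FactRing_def ring.simps)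
      ultimately show ?thesis unfolding z(2) by (simp only: h.hom_mult[OF u(1) zc, symmetric])
    qed
  qed
qed

section \<open>The clutter\<close>

lemma single_in_variable_ideal:
  "keys m \<subseteq> V \<Longrightarrow> keys m \<inter> C \<noteq> {} \<Longrightarrow> (single m c :: ('v, 'k::field) mpoly) \<in> variable_ideal V C"
  by (auto simp: variable_ideal_def single_in_carrier)

text \<open>Terms that meet \<open>C\<close> go into \<open>y\<close>; each remaining term must meet
  \<open>D\<close>.\<close>

lemma variable_ideal_Un:
  fixes x :: "('v, 'k::field) mpoly"
  assumes "x \<in> variable_ideal V (C \<union> D)"
  shows "\<exists>y\<in>variable_ideal V C. \<exists>z\<in>variable_ideal V D. x = y + z"
proof -
  let ?t = "\<lambda>m. single m (lookup x m)"
  let ?K = "{m \<in> keys x. keys m \<inter> C \<noteq> {}}"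
  have keys: "keys m \<subseteq> V" "keys m \<inter> (C \<union> D) \<noteq> {}" if "m \<in> keys x" for m
    using assms that by (simp_all add: variable_ideal_def in_carrier_polynomial_ring)
  have "sum ?t ?K \<in> variable_ideal V C"
    using keys by (intro in_ideal_polynomial_ring(6)[OF ideal_variable_ideal] single_in_variable_ideal) blast+
  moreover have "sum ?t (keys x - ?K) \<in> variable_ideal V D"
    using keys by (intro in_ideal_polynomial_ring(6)[OF ideal_variable_ideal] single_in_variable_ideal) blast+
  moreover have "x = sum ?t ?K + sum ?t (keys x - ?K)"
    using sum.subset_diff[of ?K "keys x" ?t] by (simp add: sum_single_keys add.commute)
  ultimately show ?thesis by blast
qed

text \<open>Inverting the variables outside \<open>C \<union> D\<close> leaves a Stanley-Reisner complex with only the two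
  disjoint facets \<open>D - C\<close> and \<open>C - D\<close>.\<close>

lemma not_cohen_macaulay_clutter_if_two_covers:
  fixes V :: "'v::linorder set"
  assumes "clutter V E" and C: "vertex_cover V E C" and D: "vertex_cover V E D"
    and v: "v \<in> D - C" "w \<in> D - C" "v \<noteq> w" and c: "c \<in> C - D"
    and edge: "\<And>a b. a \<in> C \<Longrightarrow> b \<in> D \<Longrightarrow> \<exists>e\<in>E. e \<subseteq> {a, b} \<union> (V - (C \<union> D))"
  shows "\<not> cohen_macaulay_clutter TYPE('k::field) V E"
proof -
  let ?R = "polynomial_ring V :: ('v, 'k) mpoly ring" and ?I = "edge_ideal V E :: ('v, 'k) mpoly set"
  let ?P = "\<lambda>C. variable_ideal V C :: ('v, 'k) mpoly set"
  let ?U = "V - (C \<union> D)"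
  let ?u = "\<Prod>v\<in>?U. variable v :: ('v, 'k) mpoly"
  have V: "finite V" "C \<subseteq> V" "D \<subseteq> V" using assms by (auto simp: clutter_def vertex_cover_def)
  note I = ideal_edge_ideal[OF assms(1), where ?'k = 'k]
  have u: "?u \<in> carrier ?R" "?u \<notin> ?P (C \<union> D)"
    using V by (auto simp: prod_variable_in_carrier prod_variable_in_variable_ideal_iff)
  \<comment> \<open>Each monomial of \<open>z\<close> contains some \<open>a\<close> in
    \<open>C\<close> and some \<open>b\<close> in \<open>D\<close>, possibly equal. The factor
    \<open>?u\<close> supplies the other vertices of the edge inside
    \<open>{a, b} \<union> ?U\<close>.\<close>
  have kill: "?u * z \<in> ?I" if z: "z \<in> ?P C \<inter> ?P D" for z
  proof -
    have "?u * z = (\<Sum>m\<in>keys z. ?u * single m (lookup z m))"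
      by (subst sum_distrib_left[symmetric]) (simp add: sum_single_keys)
    also have "\<dots> = (\<Sum>m\<in>keys z. single ((\<Sum>v\<in>?U. single v 1) + m) (lookup z m))"
      using V by (simp add: prod_variable mult_single del: One_nat_def)
    also have "\<dots> \<in> ?I"
    proof (rule in_ideal_polynomial_ring(6)[OF I])
      fix m assume m: "m \<in> keys z"
      then have km: "keys m \<subseteq> V" "keys m \<inter> C \<noteq> {}" "keys m \<inter> D \<noteq> {}"
        using z by (simp_all add: variable_ideal_def in_carrier_polynomial_ring)
      then obtain a b where "a \<in> keys m" "a \<in> C" "b \<in> keys m" "b \<in> D" by blast
      then obtain e where e: "e \<in> E" "e \<subseteq> keys m \<union> ?U" using edge[of a b] by blast
      have k: "keys ((\<Sum>v\<in>?U. single v 1) + m) = ?U \<union> keys m"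
        using V by (simp add: keys_plus_nat keys_sum_single del: One_nat_def)
      show "single ((\<Sum>v\<in>?U. single v 1) + m) (lookup z m) \<in> ?I"
        by (rule single_in_ideal[OF I edge_in_edge_ideal[OF assms(1) e(1)]]) (use e k km in blast)+
    qed
    finally show ?thesis .
  qed
  \<comment> \<open>\<open>v\<close> and \<open>w\<close> separate the two steps of the chain that
    gives dimension two; \<open>v\<close> and \<open>c\<close> make the two primes
    incomparable.\<close>
  have "\<not> cohen_macaulay (?R Quot ?I)"
  proof (rule not_cohen_macaulay_quotient[OF cring_polynomial_ring I,
        where p = "?P (C \<union> D)" and ?P1.0 = "?P C" and ?P2.0 = "?P D" and Q = "?P (insert v C)" and u = ?u])
    show "?P C \<subset> ?P (insert v C)" using v V by (intro variable_ideal_strict_mono) auto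
    show "?P (insert v C) \<subset> ?P (C \<union> D)"
      using v V by (intro variable_ideal_strict_mono[where v = w]) auto
    show "?P D \<subseteq> ?P (C \<union> D)" by (auto simp: variable_ideal_def)
    have "variable v \<in> ?P D" "variable v \<notin> ?P C" "variable c \<in> ?P C" "variable c \<notin> ?P D"
      using v c V by (auto simp: variable_in_variable_ideal_iff)
    then show "\<not> ?P C \<subseteq> ?P D" "\<not> ?P D \<subseteq> ?P C" by blast+
    show "\<exists>y\<in>?P C. \<exists>z\<in>?P D. x = y \<oplus>\<^bsub>?R\<^esub> z" if "x \<in> ?P (C \<union> D)" for x
      using variable_ideal_Un[OF that] by simp
    show "?u \<otimes>\<^bsub>?R\<^esub> z \<in> ?I" if "z \<in> ?P C \<inter> ?P D" for z
      using kill[OF that] by simp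
  qed (use u C D in \<open>auto intro!: primeideal_variable_ideal edge_ideal_subset_variable_ideal[OF assms(1)]\<close>)
  then show ?thesis by (simp add: cohen_macaulay_clutter_def)
qed

text \<open>Values of \<open>f\<close> start at 0 and classes at 1, hence \<open>i - 1\<close>.
  Surjectivity makes the classes nonempty and distinct.\<close>

lemma indexed_partition_fibers:
  assumes "f ` V = {..<n}"
  shows "indexed_partition V n (\<lambda>i. {x \<in> V. f x = i - 1})"
proof -
  have ne: "\<exists>x\<in>V. f x = i - 1" if "i \<in> {1..n}" for i
  proof -
    have "i - 1 \<in> f ` V" unfolding assms using that by auto
    then show ?thesis by force
  qed
  have "x \<in> (\<Union>i\<in>{1..n}. {x \<in> V. f x = i - 1})" if "x \<in> V" for x
  proof -
    have "f x < n" using assms that by auto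
    then show ?thesis using that by (intro UN_I[of "Suc (f x)"]) auto
  qed
  then have "(\<Union>i\<in>{1..n}. {x \<in> V. f x = i - 1}) = V" by blast
  moreover have "inj_on (\<lambda>i. {x \<in> V. f x = i - 1}) {1..n}"
  proof (rule inj_onI)
    fix i j assume *: "i \<in> {1..n}" "j \<in> {1..n}" "{x \<in> V. f x = i - 1} = {x \<in> V. f x = j - 1}"
    obtain x where "x \<in> V" "f x = i - 1" using ne[OF *(1)] by blast
    then have "i - 1 = j - 1" using *(3) by auto
    then show "i = j" using *(1,2) by auto
  qed
  ultimately show ?thesis
    unfolding indexed_partition_def partition_on_def disjoint_def using ne by fastforce
qed

text \<open>Vertex \<open>3 i + j\<close> lies in the \<open>i\<close>-th block and the \<open>j\<close>-th colour class. The four crossing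
  edges were found by computer search.\<close>

definition block :: "nat \<Rightarrow> nat set" where
  "block i = {3 * i, 3 * i + 1, 3 * i + 2}"

definition crossing_edges :: "nat set set" where
  "crossing_edges = {{0, 4, 8}, {0, 7, 8}, {3, 4, 11}, {3, 7, 11}}"

definition edges :: "nat \<Rightarrow> nat set set" where
  "edges g = block ` {..<g} \<union> crossing_edges"

lemma in_block_iff: "x \<in> block i \<longleftrightarrow> x div 3 = i"
  unfolding block_def by auto

text \<open>Treats blocks and crossing edges alike, so that size, range and admissibility of edges
  follow without another case distinction.\<close>

lemma edges_form:
  assumes "4 \<le> g" "e \<in> edges g"
  obtains a b c where "e = {a, b, c}" "a mod 3 = 0" "b mod 3 = 1" "c mod 3 = 2"
    "a div 3 \<le> b div 3" "b div 3 \<le> c div 3" "c < 3 * g"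
proof (cases "e \<in> crossing_edges")
  case True
  then show ?thesis
    unfolding crossing_edges_def using assms(1)
    by (auto intro: that[of 0 4 8] that[of 0 7 8] that[of 3 4 11] that[of 3 7 11])
next
  case False
  then obtain i where "i < g" "e = block i" using assms(2) by (auto simp: edges_def)
  then show ?thesis by (intro that[of "3 * i" "3 * i + 1" "3 * i + 2"]) (auto simp: block_def, presburger)
qed

lemma card_edge:
  assumes "4 \<le> g" "e \<in> edges g"
  shows "card e = 3"
proof -
  obtain a b c where e: "e = {a, b, c}" "a mod 3 = 0" "b mod 3 = 1" "c mod 3 = 2"
    using edges_form[OF assms] by metis
  then have "a \<noteq> b" "a \<noteq> c" "b \<noteq> c" by auto
  then show ?thesis using e by simp
qed

lemma edge_subset:
  assumes "4 \<le> g" "e \<in> edges g"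
  shows "e \<subseteq> {..<3 * g}"
proof -
  obtain a b c where e: "e = {a, b, c}" "a mod 3 = 0" "b mod 3 = 1" "c mod 3 = 2"
    "a div 3 \<le> b div 3" "b div 3 \<le> c div 3" "c < 3 * g"
    using edges_form[OF assms] by metis
  then have "a \<le> c" "b \<le> c"
    using mult_div_mod_eq[of 3 a] mult_div_mod_eq[of 3 b] mult_div_mod_eq[of 3 c] by linarith+
  then show ?thesis using e by auto
qed

lemma clutter_edges:
  assumes "4 \<le> g"
  shows "clutter {..<3 * g} (edges g)"
  unfolding clutter_def
proof (intro conjI ballI)
  fix e assume e: "e \<in> edges g"
  show "e \<noteq> {}" using card_edge[OF assms e] by auto
  show "e \<subseteq> {..<3 * g}" by (rule edge_subset[OF assms e])
  fix f assume f: "f \<in> edges g"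
  have "finite f" using card_edge[OF assms f] by (intro card_ge_0_finite) simp
  then show "\<not> e \<subset> f"
    using psubset_card_mono[of f e] card_edge[OF assms e] card_edge[OF assms f] by auto
qed simp

text \<open>\<open>x div 3\<close> is the block of \<open>x\<close>, and every block is an edge.
  Knowing the exact image turns injectivity on a cover into cardinality \<open>g\<close>.\<close>

lemma blocks_covered:
  assumes "vertex_cover {..<3 * g} (edges g) C"
  shows "(\<lambda>x. x div 3) ` C = {..<g}"
proof
  show "(\<lambda>x. x div 3) ` C \<subseteq> {..<g}"
    using assms by (auto simp: vertex_cover_def div_less_iff_less_mult mult.commute)
  show "{..<g} \<subseteq> (\<lambda>x. x div 3) ` C"
  proof
    fix i assume "i \<in> {..<g}"
    then have "C \<inter> block i \<noteq> {}" using assms by (auto simp: vertex_cover_def edges_def)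
    then show "i \<in> (\<lambda>x. x div 3) ` C" by (auto simp: in_block_iff)
  qed
qed

lemma card_vertex_cover_ge:
  assumes "vertex_cover {..<3 * g} (edges g) C"
  shows "g \<le> card C"
proof -
  have "finite C" using assms finite_subset by (auto simp: vertex_cover_def)
  then show ?thesis
    using card_image_le[of C "\<lambda>x. x div 3"] blocks_covered[OF assms] by simp
qed

lemma minimal_vertex_cover_private_edge:
  assumes "minimal_vertex_cover V E C" "x \<in> C"
  obtains e where "e \<in> E" "x \<in> e" "\<And>z. z \<in> e \<Longrightarrow> z \<in> C \<Longrightarrow> z = x"
proof -
  have "\<not> vertex_cover V E (C - {x})" "vertex_cover V E C"
    using assms by (auto simp: minimal_vertex_cover_def)
  then obtain e where "e \<in> E" "(C - {x}) \<inter> e = {}" "C \<inter> e \<noteq> {}"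
    by (auto simp: vertex_cover_def)
  then show ?thesis using that by blast
qed

text \<open>Two vertices of one block in a minimal cover would have private edges \<open>e\<close> and \<open>f\<close>; but then
  \<open>e \<union> f\<close> contains an edge that avoids both vertices and hence the whole cover.\<close>

lemma card_minimal_vertex_cover:
  assumes C: "minimal_vertex_cover {..<3 * g} (edges g) C"
  shows "card C = g"
proof -
  have cover: "vertex_cover {..<3 * g} (edges g) C" using C by (simp add: minimal_vertex_cover_def)
  then have "\<forall>e\<in>crossing_edges. C \<inter> e \<noteq> {}"
    by (auto simp: vertex_cover_def edges_def)
  then have meets: "0 \<in> C \<or> 4 \<in> C \<or> 8 \<in> C" "0 \<in> C \<or> 7 \<in> C \<or> 8 \<in> C"
    "3 \<in> C \<or> 4 \<in> C \<or> 11 \<in> C" "3 \<in> C \<or> 7 \<in> C \<or> 11 \<in> C"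
    by (simp_all add: crossing_edges_def)
  have "inj_on (\<lambda>x. x div 3) C"
  proof (rule inj_onI, rule ccontr)
    fix x y assume xy: "x \<in> C" "y \<in> C" "x div 3 = y div 3" "x \<noteq> y"
    obtain e where e: "e \<in> edges g" "x \<in> e" "\<And>z. z \<in> e \<Longrightarrow> z \<in> C \<Longrightarrow> z = x"
      using minimal_vertex_cover_private_edge[OF C xy(1)] by metis
    obtain f where f: "f \<in> edges g" "y \<in> f" "\<And>z. z \<in> f \<Longrightarrow> z \<in> C \<Longrightarrow> z = y"
      using minimal_vertex_cover_private_edge[OF C xy(2)] by metis
    have "y \<notin> e" "x \<notin> f" using e(3)[of y] f(3)[of x] xy by auto
    then have "e \<noteq> block i" "f \<noteq> block i" for i
      using e(2) f(2) xy(3) in_block_iff by metis+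
    then have ef: "e \<in> crossing_edges" "f \<in> crossing_edges" using e(1) f(1) by (auto simp: edges_def)
    then have "x \<in> {0, 3, 4, 7, 8, 11}" "y \<in> {0, 3, 4, 7, 8, 11}"
      using e(2) f(2) by (auto simp: crossing_edges_def)
    \<comment> \<open>Among the vertices of crossing edges, only 3, 4 and 7, 8 share a
      block.\<close>
    then consider "x = 3" "y = 4" | "x = 4" "y = 3" | "x = 7" "y = 8" | "x = 8" "y = 7"
      using xy(3,4) by (elim insertE emptyE) simp_all
    moreover have "\<forall>z\<in>e. z \<in> C \<longrightarrow> z = x" "\<forall>z\<in>f. z \<in> C \<longrightarrow> z = y" using e(3) f(3) by blast+
    \<comment> \<open>In every case the private edges are {3,7,11} and {0,4,8}. For the pair 3, 4
      the uncovered edge is {0,7,8}; for the pair 7, 8 it is {3,4,11}.\<close>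
    ultimately show False
      using ef e(2) f(2) \<open>y \<notin> e\<close> \<open>x \<notin> f\<close> meets unfolding crossing_edges_def
      by cases (elim insertE emptyE; simp)+
  qed
  then show ?thesis using card_image[of "\<lambda>x. x div 3" C] blocks_covered[OF cover] by simp
qed

definition transversal :: "nat \<Rightarrow> (nat \<Rightarrow> nat) \<Rightarrow> nat set" where
  "transversal g t = {x. x < 3 * g \<and> x mod 3 = t (x div 3)}"

lemma vertex_cover_transversal:
  assumes "4 \<le> g" "\<And>i. t i < 3" "\<And>e. e \<in> crossing_edges \<Longrightarrow> transversal g t \<inter> e \<noteq> {}"
  shows "vertex_cover {..<3 * g} (edges g) (transversal g t)"
proof -
  have "3 * i + t i \<in> transversal g t \<inter> block i" if "i < g" for i
    using that assms(2)[of i] by (auto simp: transversal_def in_block_iff)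
  then show ?thesis
    using assms(3) unfolding vertex_cover_def edges_def by (fastforce simp: transversal_def)
qed

lemma card_transversal:
  assumes "vertex_cover {..<3 * g} (edges g) (transversal g t)"
  shows "card (transversal g t) = g"
proof -
  have "inj_on (\<lambda>x. x div 3) (transversal g t)"
    by (rule inj_onI) (metis (mono_tags, lifting) mem_Collect_eq mult_div_mod_eq transversal_def)
  then show ?thesis
    using card_image blocks_covered[OF assms] card_lessThan by metis
qed

text \<open>This is {1, 3, 8, 9, 12, ...}, and \<open>cover2\<close> is {1, 4, 7, 9, 12, ...}. They
  differ only in blocks 1 and 2, where they select the opposite pairs {3, 8} and {4, 7} of the
  four-cycle.\<close>

definition cover1 :: "nat \<Rightarrow> nat set" where
  "cover1 g = transversal g (\<lambda>i. if i = 0 then 1 else if i = 2 then 2 else 0)"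

definition cover2 :: "nat \<Rightarrow> nat set" where
  "cover2 g = transversal g (\<lambda>i. if i < 3 then 1 else 0)"

lemma
  assumes "4 \<le> g"
  shows vertex_cover_cover1: "vertex_cover {..<3 * g} (edges g) (cover1 g)"
    and vertex_cover_cover2: "vertex_cover {..<3 * g} (edges g) (cover2 g)"
proof -
  have "3 \<in> cover1 g" "8 \<in> cover1 g" "4 \<in> cover2 g" "7 \<in> cover2 g"
    using assms by (simp_all add: cover1_def cover2_def transversal_def)
  then have "cover1 g \<inter> e \<noteq> {}" "cover2 g \<inter> e \<noteq> {}" if "e \<in> crossing_edges" for e
    using that unfolding crossing_edges_def by blast+
  then show "vertex_cover {..<3 * g} (edges g) (cover1 g)" "vertex_cover {..<3 * g} (edges g) (cover2 g)"
    unfolding cover1_def cover2_def by (auto intro!: vertex_cover_transversal[OF assms])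
qed

lemma not_cohen_macaulay_edges:
  assumes "4 \<le> g"
  shows "\<not> cohen_macaulay_clutter TYPE('k::field) {..<3 * g} (edges g)"
proof (rule not_cohen_macaulay_clutter_if_two_covers[OF clutter_edges[OF assms]
      vertex_cover_cover1[OF assms] vertex_cover_cover2[OF assms], where v = 4 and w = 7 and c = 3])
  have less: "x < 3 * g" if "x < 12" for x using that assms by simp
  then show "4 \<in> cover2 g - cover1 g" "7 \<in> cover2 g - cover1 g" "3 \<in> cover1 g - cover2 g"
    by (auto simp: cover1_def cover2_def transversal_def)
  fix a b assume a: "a \<in> cover1 g" and b: "b \<in> cover2 g"
  let ?W = "cover1 g \<union> cover2 g"
  let ?S = "{a, b} \<union> ({..<3 * g} - ?W)"
  have W: "x \<in> ?W \<longleftrightarrow> x \<in> {1, 3, 4, 7, 8, 9}" if "x < 12" for x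
  proof -
    have "x \<in> {0, 1, 2, 3, 4, 5, 6, 7, 8, 9, 10, 11}" using that by simp presburger
    then show ?thesis using less[OF that]
      by (elim insertE emptyE) (auto simp: cover1_def cover2_def transversal_def)
  qed
  \<comment> \<open>Outside blocks 1 and 2 the covers agree, so \<open>z\<close> is the only vertex
    of its block in \<open>?W\<close>, and the block itself is the required edge.\<close>
  have single: "block (z div 3) \<in> edges g \<and> block (z div 3) \<subseteq> ?S"
    if "z \<in> {a, b}" "z div 3 = 0 \<or> 3 \<le> z div 3" for z
  proof
    have z: "z < 3 * g" using that a b by (auto simp: cover1_def cover2_def transversal_def)
    then show "block (z div 3) \<in> edges g" by (auto simp: edges_def div_less_iff_less_mult mult.commute)
    show "block (z div 3) \<subseteq> ?S"
    proof
      fix x assume "x \<in> block (z div 3)"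
      then have x: "x div 3 = z div 3" by (simp add: in_block_iff)
      then have "x < 3 * g"
        using z div_less_iff_less_mult[of 3 x g] div_less_iff_less_mult[of 3 z g] by simp
      moreover have "x = z" if "x \<in> ?W"
      proof -
        have "x mod 3 = z mod 3"
          using that a b x \<open>z \<in> {a, b}\<close> \<open>z div 3 = 0 \<or> 3 \<le> z div 3\<close>
          by (auto simp: cover1_def cover2_def transversal_def split: if_splits)
        then show ?thesis using x by (metis mult_div_mod_eq)
      qed
      ultimately show "x \<in> ?S" using that(1) by blast
    qed
  qed
  show "\<exists>e\<in>edges g. e \<subseteq> ?S"
  proof (cases "a div 3 \<in> {1, 2} \<and> b div 3 \<in> {1, 2}")
    case False
    then consider "a div 3 = 0 \<or> 3 \<le> a div 3" | "b div 3 = 0 \<or> 3 \<le> b div 3" by fastforce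
    then show ?thesis using single[of a] single[of b] by cases blast+
  next
    case True
    then have "a \<in> {3, 8}" "b \<in> {4, 7}"
      using a b unfolding cover1_def cover2_def transversal_def
      by (auto split: if_splits) presburger+
    then have ab: "a = 3 \<or> a = 8" "b = 4 \<or> b = 7" by simp_all
    have avoid: "x \<in> ?S" if "x < 12" "x \<in> {0, 2, 5, 6, 10, 11}" for x
      using W[OF that(1)] that less by auto
    have S: "0 \<in> ?S" "5 \<in> ?S" "6 \<in> ?S" "11 \<in> ?S" by (rule avoid; simp)+
    have S': "a \<in> ?S" "b \<in> ?S" by simp_all
    have "block 1 \<in> edges g" "block 2 \<in> edges g"
      using assms unfolding edges_def by (intro UnI1 imageI; simp)+
    then have E: "{3, 4, 5} \<in> edges g" "{6, 7, 8} \<in> edges g" by (simp_all add: block_def)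
    have E': "{3, 7, 11} \<in> edges g" "{0, 4, 8} \<in> edges g"
      by (simp_all add: edges_def crossing_edges_def)
    have "{a, b, 5} \<subseteq> ?S" "{a, b, 6} \<subseteq> ?S" "{a, b, 11} \<subseteq> ?S" "{a, b, 0} \<subseteq> ?S"
      by (simp_all only: insert_subset S S' empty_subsetI simp_thms)
    \<comment> \<open>The four edges of the cycle: 3, 4 with 5; 7, 8 with 6; 3, 7 with 11; 4, 8 with
      0.\<close>
    moreover have "{a, b, 5} \<in> edges g \<or> {a, b, 6} \<in> edges g \<or> {a, b, 11} \<in> edges g \<or> {a, b, 0} \<in> edges g"
      using ab E E' by (elim disjE) (simp_all add: insert_commute)
    ultimately show ?thesis by (elim disjE) (erule bexI[rotated]; assumption)+
  qed
qed simp

text \<open>Residues modulo 3 serve as the \<open>d = 3\<close> colour classes and the blocks as the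
  second partition; \<open>edges_form\<close> then contains the order condition.\<close>

lemma admissible_edges:
  assumes g: "4 \<le> g" and ht: "edge_ideal_height TYPE('k::field) {..<3 * g} (edges g) = enat g"
  shows "admissible TYPE('k) {..<3 * g} (edges g)"
proof -
  let ?V = "{..<3 * g}"
  define X where "X = (\<lambda>i. {x \<in> ?V. x mod 3 = i - 1})"
  define B where "B = (\<lambda>i. {x \<in> ?V. x div 3 = i - 1})"
  have "(\<lambda>x. x mod 3) ` ?V = {..<3}"
  proof safe
    fix j :: nat assume "j < 3"
    then show "j \<in> (\<lambda>x. x mod 3) ` ?V" using g by (intro image_eqI[of _ _ j]) auto
  qed simp
  then have X: "indexed_partition ?V 3 X"
    unfolding X_def by (rule indexed_partition_fibers)
  have "(\<lambda>x. x div 3) ` ?V = {..<g}"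
  proof safe
    fix j :: nat assume "j < g"
    then show "j \<in> (\<lambda>x. x div 3) ` ?V" by (intro image_eqI[of _ _ "3 * j"]) auto
  qed (auto simp: div_less_iff_less_mult mult.commute)
  then have B: "indexed_partition ?V g B"
    unfolding B_def by (rule indexed_partition_fibers)
  have BX: "card (B i \<inter> X j) \<le> 1" for i j
  proof -
    \<comment> \<open>Truncated subtraction makes index 0 behave like index 1, so the bound holds
      for all \<open>i\<close> and \<open>j\<close>.\<close>
    have "B i \<inter> X j \<subseteq> {3 * (i - 1) + (j - 1)}"
    proof
      fix x assume "x \<in> B i \<inter> X j"
      then show "x \<in> {3 * (i - 1) + (j - 1)}"
        using mult_div_mod_eq[of 3 x] by (simp add: B_def X_def)
    qed
    then show ?thesis using card_mono[of "{3 * (i - 1) + (j - 1)}"] by fastforce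
  qed
  have Bedge: "B i \<in> edges g" if "i \<in> {1..g}" for i
  proof -
    have "i - 1 < g" using that by auto
    moreover from this have "B i = block (i - 1)"
      by (auto simp: B_def in_block_iff)
    ultimately show ?thesis by (auto simp: edges_def)
  qed
  have "admissible_set ?V 3 X g B e" if e: "e \<in> edges g" for e
  proof -
    obtain a b c where abc: "e = {a, b, c}" "a mod 3 = 0" "b mod 3 = 1" "c mod 3 = 2"
      "a div 3 \<le> b div 3" "b div 3 \<le> c div 3"
      using edges_form[OF g e] by metis
    have V: "e \<subseteq> ?V" by (rule edge_subset[OF g e])
    have X123: "e \<inter> X (Suc 0) = {a}" "e \<inter> X 2 = {b}" "e \<inter> X 3 = {c}"
      using abc V by (auto simp: X_def)
    have three: "{1..3} = {1, 2, 3 :: nat}" by auto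
    have B_iff: "x \<in> B i \<longleftrightarrow> x \<in> ?V \<and> i = Suc (x div 3)" if "i \<in> {1..g}" for i x
      using that by (auto simp: B_def)
    show ?thesis
      unfolding admissible_set_def card_edge[OF g e] three using V abc(5,6)
      by (auto simp: X123 B_iff)
  qed
  then show ?thesis
    unfolding admissible_def
    using ht X B BX Bedge by (intro exI[of _ g] exI[of _ 3] exI[of _ X] exI[of _ B]) auto
qed

theorem theorem5p5:
  fixes g :: nat
  assumes "g \<ge> 4"
  shows "\<exists>(V :: nat set) (E :: nat set set).
    clutter V E \<and> uniform E \<and> admissible TYPE('k::field) V E \<and> unmixed V E \<and>
    edge_ideal_height TYPE('k) V E = enat g \<and>
    \<not> cohen_macaulay_clutter TYPE('k) V E"
proof -
  have ht: "edge_ideal_height TYPE('k) {..<3 * g} (edges g) = enat g"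
    using vertex_cover_cover1[OF assms] card_transversal card_vertex_cover_ge
    by (intro edge_ideal_height_eq[OF clutter_edges[OF assms]]) (auto simp: cover1_def)
  moreover have "uniform (edges g)"
    using card_edge[OF assms] by (simp add: uniform_def)
  moreover have "unmixed {..<3 * g} (edges g)"
    using card_minimal_vertex_cover by (simp add: unmixed_def)
  ultimately show ?thesis
    using clutter_edges[OF assms] admissible_edges[OF assms ht] not_cohen_macaulay_edges[OF assms]
    by blast
qed

end
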